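(* Let $G'$ be a graph and let $v\in V(G')$ be a vertex of degree $d\ge 1$. Let $G=G'-v$ and let $\Pi$ be any fixed orientable embedding of $G$. Let $\Pi'$ be the random embedding of $G'$ obtained by randomly adding $v$ to $\Pi$. Define $h(d)=\Delta_d$ for $1\le d\le 4$ and $h(d)=\Delta_d+\frac{1}{d+1}$ for $d\ge 5$, where $\Delta_d=H_{d-1}+\lceil d/2\rceil^{-1}$. Then the expected number of faces of $\Pi'$ containing $v$ is at most $h(d)$.
   Context: An orientable 2-cell embedding of a graph is identified with a rotation system: for each vertex $u$ a cyclic permutation $\pi_u$ of the darts (half-edges) with tail $u$. The faces are the orbits of the permutation $\sigma\cdot\prod_u\pi_u$ on darts, where $\sigma$ swaps the two darts $xy$ and $yx$ of each edge. A face contains $v$ if its facial walk passes through $v$. Randomly adding $v$ to $\Pi=\{\pi_u\}$ is the following procedure, with all choices independent. (1) For each neighbor $u$ of $v$, insert the dart $uv$ uniformly at random into one of the gaps between consecutive darts of $\pi_u$, giving $\pi'_u$; other vertices keep $\pi'_u=\pi_u$. (2) Choose $\pi'_v$ uniformly at random among the cyclic permutations of the darts at $v$. $H_m=1+\tfrac12+\cdots+\tfrac1m$ is the $m$-th harmonic number, with $H_0=0$. *)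

theory Defs
  imports
    "HOL-Combinatorics.Orbits"
    "HOL-Analysis.Harmonic_Numbers"
    "HOL-Probability.Product_PMF"
    "Graph_Theory.Pair_Digraph"
begin

text \<open>
  A finite simple graph is a \<^locale>\<open>pair_graph\<close>: a finite, loop-free, symmetric digraph whose arcs
  are pairs of vertices. The arcs \<open>(x, y)\<close> and \<open>(y, x)\<close> are the two darts of the edge \<open>xy\<close>, and
  the dart \<open>(x, y)\<close> has tail \<open>x\<close>.
\<close>

text \<open>
  \<^const>\<open>cyclic_on\<close> is false on the empty set; the rotation at an isolated vertex is the (trivial)
  permutation of no darts.
\<close>

definition cyclic_perms :: "'b set \<Rightarrow> ('b \<Rightarrow> 'b) set" where
  "cyclic_perms S = {p. p permutes S \<and> (S = {} \<or> cyclic_on p S)}"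

type_synonym 'a rotations = "'a \<Rightarrow> 'a \<times> 'a \<Rightarrow> 'a \<times> 'a"

definition rotation_system :: "('a, 'a \<times> 'a) pre_digraph \<Rightarrow> 'a rotations \<Rightarrow> bool" where
  "rotation_system G \<pi> \<longleftrightarrow> (\<forall>u \<in> verts G. \<pi> u \<in> cyclic_perms (out_arcs G u))"

text \<open>
  The rotations at distinct vertices have disjoint supports, so their product maps a dart \<open>a\<close> to
  \<open>\<pi> (fst a) a\<close>. Composing with \<^const>\<open>prod.swap\<close> in the other order conjugates the permutation by
  \<^const>\<open>prod.swap\<close>, which preserves the number of orbits that meet a given vertex.
\<close>

definition face_perm :: "'a rotations \<Rightarrow> 'a \<times> 'a \<Rightarrow> 'a \<times> 'a" where
  "face_perm \<pi> = prod.swap \<circ> (\<lambda>a. \<pi> (fst a) a)"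

definition faces :: "('a, 'a \<times> 'a) pre_digraph \<Rightarrow> 'a rotations \<Rightarrow> ('a \<times> 'a) set set" where
  "faces G \<pi> = orbit (face_perm \<pi>) ` arcs G"

definition face_contains :: "('a \<times> 'a) set \<Rightarrow> 'a \<Rightarrow> bool" where
  "face_contains F v \<longleftrightarrow> (\<exists>a \<in> F. fst a = v \<or> snd a = v)"

text \<open>
  The gaps of a cyclic permutation \<open>p\<close> of \<open>S\<close> correspond to the elements \<open>a\<close> of \<open>S\<close>, the gap lying
  between \<open>a\<close> and \<open>p a\<close>. If \<open>S\<close> is empty, the only cyclic permutation of \<open>{x}\<close> is \<^const>\<open>id\<close>.
\<close>

definition random_insert :: "('b \<Rightarrow> 'b) \<Rightarrow> 'b set \<Rightarrow> 'b \<Rightarrow> ('b \<Rightarrow> 'b) pmf" where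
  "random_insert p S x =
     (if S = {} then return_pmf id
      else map_pmf (\<lambda>a. p(a := x, x := p a)) (pmf_of_set S))"

text \<open>\<open>G'\<close> is the graph after the addition of \<open>v\<close>, and \<open>\<pi>\<close> is a rotation system of \<open>G' - v\<close>.\<close>

definition randomly_add_vertex ::
    "('a, 'a \<times> 'a) pre_digraph \<Rightarrow> 'a \<Rightarrow> 'a rotations \<Rightarrow> 'a rotations pmf" where
  "randomly_add_vertex G' v \<pi> =
     Pi_pmf (verts G') id
       (\<lambda>u. if u = v then pmf_of_set (cyclic_perms (out_arcs G' v))
            else if (u, v) \<in> arcs G'
              then random_insert (\<pi> u) (out_arcs (pre_digraph.del_vert G' v) u) (u, v)
            else return_pmf (\<pi> u))"

definition Delta_bound :: "nat \<Rightarrow> real" where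
  "Delta_bound d = harm (d - 1) + inverse (real_of_int \<lceil>real d / 2\<rceil>)"

text \<open>Only the values at \<open>d \<ge> 1\<close> are meaningful.\<close>

definition h_bound :: "nat \<Rightarrow> real" where
  "h_bound d = (if d \<le> 4 then Delta_bound d else Delta_bound d + 1 / (real d + 1))"

end

theory Submission
  imports Defs
begin

text \<open>
  Once the rotations at the other vertices are fixed, the first-return map of the face permutation
  to the \<open>d\<close> darts at \<open>v\<close> is \<open>\<tau> \<circ> \<rho>\<close>, where \<open>\<tau>\<close> is a fixed permutation and \<open>\<rho>\<close> is a uniformly random
  \<open>d\<close>-cycle. So it suffices to bound the expected number of cycles of \<open>\<tau> \<circ> \<rho>\<close> for each \<open>\<tau>\<close>; this
  number is exactly
  \<open>\<integral>\<^sub>0\<^sup>1 (1 - (1 - t) \<Prod>\<^sub>C ((1 - t)\<^bsup>|C|\<^esup> - (- t)\<^bsup>|C|\<^esup>)) / t dt\<close>, with \<open>C\<close> ranging over the cycles of \<open>\<tau>\<close>.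
  The formula is proved by induction on \<open>d\<close>: revealing \<open>\<rho> x = y\<close> and contracting \<open>x\<close> joins or splits
  cycles of \<open>\<tau>\<close>, and the resulting recursion holds for the integrands up to an exact derivative.

  Folding the integral at \<open>t = 1 / 2\<close> and substituting \<open>t = (1 - z\<^sup>2) / 2\<close>, each factor is at least
  \<open>z\<^bsup>|C|\<^esup>\<close>, so the integrand is at most \<open>4 z (1 - z\<^bsup>d+2\<^esup>) / (1 - z\<^sup>4)\<close>. This is dominated by a function
  with integral \<open>H\<^bsub>d-1\<^esub> + 5/4 (1/d + 1/(d+1))\<close>, which is small enough for \<open>d \<ge> 5\<close>. The cases
  \<open>d \<le> 4\<close> are evaluated exactly.
\<close>

section \<open>Random cyclic permutations\<close>

text \<open>The first-return map of \<open>p\<close> to the complement of \<open>x\<close>, extended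
  by fixing \<open>x\<close>: the predecessor of \<open>x\<close> is sent on to
  \<open>p x\<close>.\<close>

definition del_point :: "'b \<Rightarrow> ('b \<Rightarrow> 'b) \<Rightarrow> 'b \<Rightarrow> 'b" where
  "del_point x p = Transposition.transpose x (p x) \<circ> p"

text \<open>If \<open>\<rho> x = y\<close>, then \<open>\<rho>\<close> is
  \<open>transpose x y\<close> after a cycle \<open>\<rho>'\<close> that fixes \<open>x\<close>, and
  deleting \<open>x\<close> from \<open>\<tau> \<circ> \<rho>\<close> leaves
  \<open>contract \<tau> x y \<circ> \<rho>'\<close>.\<close>

abbreviation contract :: "('b \<Rightarrow> 'b) \<Rightarrow> 'b \<Rightarrow> 'b \<Rightarrow> 'b \<Rightarrow> 'b" where
  "contract \<tau> x y \<equiv> del_point x (\<tau> \<circ> Transposition.transpose x y)"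

lemma del_point_permutes:
  assumes "p permutes S" "x \<in> S"
  shows "del_point x p permutes (S - {x})"
proof (rule permutes_superset)
  show "del_point x p permutes S"
    unfolding del_point_def
    using assms by (intro permutes_compose permutes_swap_id) (auto simp: permutes_in_image)
qed (auto simp: del_point_def)

lemma del_point_apply:
  assumes "inj p" "u \<noteq> x"
  shows "del_point x p u = (if p u = x then p x else p u)"
  using assms by (auto simp: del_point_def Transposition.transpose_def dest: injD)

text \<open>Both products send \<open>x\<close> to \<open>p x\<close>, so the same transposition
  occurs; deletion thus acts on the left factor alone.\<close>

lemma del_point_comp:
  "\<rho> x = x \<Longrightarrow> del_point x (p \<circ> \<rho>) = del_point x p \<circ> \<rho>"
  by (simp add: del_point_def fun_eq_iff)

lemma orbit_del_point:
  assumes p: "p permutes S" and x: "x \<in> S" and u: "u \<noteq> x"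
  shows "orbit (del_point x p) u = orbit p u - {x}"
proof -
  let ?q = "del_point x p"
  have inj: "inj p" using p by (rule permutes_inj)
  have q: "?q permutes S - {x}" using p x by (rule del_point_permutes)
  have ne: "y \<noteq> x" if "y \<in> orbit ?q u" for y
    using that
  proof induct
    case base
    show ?case using permutes_inj[OF q] u by (metis Diff_iff injD insertI1 permutes_not_in q)
  next
    case (step y)
    then show ?case using permutes_inj[OF q] by (metis Diff_iff injD insertI1 permutes_not_in q)
  qed
  have sub: "y \<in> orbit p u" if "y \<in> orbit ?q u" for y
    using that
  proof induct
    case base
    show ?case using u inj by (auto simp: del_point_apply intro: orbit.intros orbit_eqI)
  next
    case (step y)
    then show ?case using ne[of y] inj by (auto simp: del_point_apply intro: orbit.intros orbit_eqI)
  qed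
  \<comment> \<open>The invariant for a walk along \<open>p\<close>: when it stands on
    \<open>x\<close>, the walk along \<open>?q\<close> has already jumped ahead to
    \<open>p x\<close>.\<close>
  have sup: "y \<in> orbit ?q u \<or> (y = x \<and> p x \<in> orbit ?q u)" if "y \<in> orbit p u" for y
    using that
  proof induct
    case base
    show ?case using u inj orbit.base[of ?q u] by (auto simp: del_point_apply split: if_splits)
  next
    case (step y)
    then show ?case
      using ne[of y] inj orbit.step[of y ?q u] by (auto simp: del_point_apply split: if_splits)
  qed
  show ?thesis using ne sub sup by blast
qed

lemma orbit_eq_iff_mem:
  assumes "permutation p"
  shows "orbit p u = orbit p w \<longleftrightarrow> u \<in> orbit p w"
  using assms by (metis cyclic_on_orbit' orbit_cyclic_eq3 permutation_self_in_orbit)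

text \<open>An orbit through \<open>D\<close> has a point other than \<open>x\<close>, so it can be
  recovered from what is left after removing \<open>x\<close>.\<close>

lemma card_orbits_del_point:
  assumes p: "p permutes S" and fin: "finite S" and x: "x \<in> S" and D: "D \<subseteq> S - {x}"
  shows "card (orbit (del_point x p) ` D) = card (orbit p ` D)"
proof -
  have perm: "permutation p" using p fin by (auto simp: permutation_permutes)
  have "orbit (del_point x p) ` D = (\<lambda>C. C - {x}) ` orbit p ` D"
    unfolding image_image using D by (intro image_cong refl orbit_del_point[OF p x]) auto
  moreover have "inj_on (\<lambda>C. C - {x}) (orbit p ` D)"
  proof (rule inj_onI, clarify)
    fix u w assume uw: "u \<in> D" "w \<in> D" "orbit p u - {x} = orbit p w - {x}"
    then have "u \<in> orbit p w"
      using D permutation_self_in_orbit[OF perm, of u] by blast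
    then show "orbit p u = orbit p w" using perm by (simp add: orbit_eq_iff_mem)
  qed
  ultimately show ?thesis by (simp add: card_image)
qed

text \<open>Only the orbit \<open>{x}\<close> can get lost; a longer orbit of \<open>x\<close> is
  still represented by \<open>p x\<close>.\<close>

lemma card_orbits_eq_del_point:
  assumes p: "p permutes S" and fin: "finite S" and x: "x \<in> S"
  shows "card (orbit p ` S) = card (orbit (del_point x p) ` (S - {x})) + (if p x = x then 1 else 0)"
proof -
  have perm: "permutation p" using p fin by (auto simp: permutation_permutes)
  have S: "orbit p ` S = insert (orbit p x) (orbit p ` (S - {x}))" using x by blast
  have eq: "card (orbit (del_point x p) ` (S - {x})) = card (orbit p ` (S - {x}))"
    using card_orbits_del_point[OF p fin x] by blast
  show ?thesis
  proof (cases "p x = x")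
    case True
    then have o: "orbit p x = {x}" by (simp add: orbit_eq_singleton_iff)
    have "orbit p x \<notin> orbit p ` (S - {x})"
      using permutation_self_in_orbit[OF perm] o by auto
    then show ?thesis using True S eq fin by simp
  next
    case False
    have "p x \<in> S - {x}" using False x p by (simp add: permutes_in_image)
    then have "orbit p x \<in> orbit p ` (S - {x})"
      using permutation_orbit_step[OF perm, of x] by (metis imageI)
    then show ?thesis using False S eq by (simp add: insert_absorb)
  qed
qed

text \<open>Composing with \<open>transpose x y\<close> inserts \<open>x\<close> into the cycle just
  before \<open>y\<close>, which undoes the deletion of \<open>x\<close>.\<close>

lemma cyclic_perms_extend:
  assumes x: "x \<in> S" and y: "y \<in> S - {x}" and r: "\<rho> \<in> cyclic_perms (S - {x})"
  shows "Transposition.transpose x y \<circ> \<rho> \<in> cyclic_perms S" "(Transposition.transpose x y \<circ> \<rho>) x = y"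
    "del_point x (Transposition.transpose x y \<circ> \<rho>) = \<rho>"
proof -
  let ?p = "Transposition.transpose x y \<circ> \<rho>"
  have rp: "\<rho> permutes S - {x}" and cyc: "cyclic_on \<rho> (S - {x})"
    using r y by (auto simp: cyclic_perms_def)
  then have fin: "finite S" using finite_cyclic_on[OF cyc] by simp
  have rx: "\<rho> x = x" using rp by (simp add: permutes_not_in)
  then show px: "?p x = y" by simp
  show del: "del_point x ?p = \<rho>"
    unfolding del_point_def px by (simp add: o_assoc)
  have p: "?p permutes S"
    using rp x y by (intro permutes_compose permutes_swap_id permutes_subset[OF rp]) auto
  have perm: "permutation ?p" using p fin by (auto simp: permutation_permutes)
  have "orbit ?p y - {x} = S - {x}"
    using orbit_del_point[OF p x, of y] cyc y by (simp add: del orbit_cyclic_eq3)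
  moreover have "x \<in> orbit ?p y"
    using perm px by (metis orbit.base orbit_eq_iff_mem)
  ultimately have "orbit ?p y = S" using x by blast
  then have "cyclic_on ?p S" using y by (auto simp: cyclic_on_def)
  then show "?p \<in> cyclic_perms S" using p by (auto simp: cyclic_perms_def)
qed

lemma cyclic_perms_shrink:
  assumes x: "x \<in> S" and ne: "S - {x} \<noteq> {}" and r: "\<rho> \<in> cyclic_perms S"
  shows "\<rho> x \<in> S - {x}" "del_point x \<rho> \<in> cyclic_perms (S - {x})"
proof -
  have p: "\<rho> permutes S" and cyc: "cyclic_on \<rho> S"
    using r x by (auto simp: cyclic_perms_def)
  have "\<rho> x \<noteq> x"
    using orbit_cyclic_eq3[OF cyc x] ne by (auto simp: orbit_eq_singleton_iff[symmetric])
  then show "\<rho> x \<in> S - {x}" using p x by (simp add: permutes_in_image)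
  obtain y where y: "y \<in> S - {x}" using ne by blast
  have "orbit (del_point x \<rho>) y = S - {x}"
    using orbit_del_point[OF p x, of y] y orbit_cyclic_eq3[OF cyc, of y] by auto
  then have "cyclic_on (del_point x \<rho>) (S - {x})" using y by (auto simp: cyclic_on_def)
  then show "del_point x \<rho> \<in> cyclic_perms (S - {x})"
    using del_point_permutes[OF p x] by (auto simp: cyclic_perms_def)
qed

text \<open>Reveals the image \<open>y\<close> of \<open>x\<close>. What remains hidden is an
  arbitrary cyclic permutation of the other points, so a uniform \<open>\<rho>\<close> stays uniform
  after the deletion of \<open>x\<close>.\<close>

lemma sum_cyclic_perms:
  assumes "x \<in> S" "S - {x} \<noteq> {}"
  shows "(\<Sum>\<rho>\<in>cyclic_perms S. g \<rho>) =
    (\<Sum>y\<in>S - {x}. \<Sum>\<rho>\<in>cyclic_perms (S - {x}). g (Transposition.transpose x y \<circ> \<rho>))"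
  unfolding sum.cartesian_product
proof (rule sum.reindex_bij_witness[where i = "\<lambda>(y, \<rho>). Transposition.transpose x y \<circ> \<rho>" and j = "\<lambda>\<rho>. (\<rho> x, del_point x \<rho>)"])
  fix \<rho> assume r: "\<rho> \<in> cyclic_perms S"
  show "(case (\<rho> x, del_point x \<rho>) of (y, \<rho>) \<Rightarrow> Transposition.transpose x y \<circ> \<rho>) = \<rho>"
    by (simp add: del_point_def o_assoc)
  then show "(case (\<rho> x, del_point x \<rho>) of (y, \<rho>) \<Rightarrow> g (Transposition.transpose x y \<circ> \<rho>)) = g \<rho>" by simp
  show "(\<rho> x, del_point x \<rho>) \<in> (S - {x}) \<times> cyclic_perms (S - {x})"
    using cyclic_perms_shrink[OF assms r] by simp
next
  fix z assume "z \<in> (S - {x}) \<times> cyclic_perms (S - {x})"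
  then obtain y \<rho> where z: "z = (y, \<rho>)" "y \<in> S - {x}" "\<rho> \<in> cyclic_perms (S - {x})" by blast
  note e = cyclic_perms_extend[OF assms(1) z(2,3)]
  show "(case z of (y, \<rho>) \<Rightarrow> Transposition.transpose x y \<circ> \<rho>) \<in> cyclic_perms S" using e z by simp
  show "((case z of (y, \<rho>) \<Rightarrow> Transposition.transpose x y \<circ> \<rho>) x, del_point x (case z of (y, \<rho>) \<Rightarrow> Transposition.transpose x y \<circ> \<rho>)) = z"
    unfolding z(1) prod.case e(2,3) ..
qed

lemma finite_cyclic_perms: "finite S \<Longrightarrow> finite (cyclic_perms S)"
  unfolding cyclic_perms_def using finite_permutations[of S] by (rule rev_finite_subset) auto

lemma cyclic_perms_singleton: "cyclic_perms {x} = {id}"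
proof -
  have "orbit id x = {x}" by (simp add: orbit_eq_singleton_iff)
  then show ?thesis by (auto simp: cyclic_perms_def cyclic_on_def)
qed

lemma card_cyclic_perms:
  assumes "finite S" "x \<in> S" "S - {x} \<noteq> {}"
  shows "card (cyclic_perms S) = (card S - 1) * card (cyclic_perms (S - {x}))"
  using sum_cyclic_perms[OF assms(2,3), of "\<lambda>_. 1::nat"] assms by (simp add: card_Diff_singleton)

lemma cyclic_perms_nonempty:
  assumes "finite S" "S \<noteq> {}"
  shows "cyclic_perms S \<noteq> {}"
  using assms
proof (induction rule: finite_ne_induct)
  case (singleton x)
  then show ?case by (simp add: cyclic_perms_singleton)
next
  case (insert x F)
  then obtain y \<rho> where "y \<in> F" "\<rho> \<in> cyclic_perms F" by auto
  then show ?case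
    using cyclic_perms_extend(1)[of x "insert x F" y \<rho>] insert by auto
qed

section \<open>The mean number of cycles and its recursion\<close>

definition mean_cycles :: "'b set \<Rightarrow> ('b \<Rightarrow> 'b) \<Rightarrow> real" where
  "mean_cycles S \<tau> =
     (\<Sum>\<rho>\<in>cyclic_perms S. real (card (orbit (\<tau> \<circ> \<rho>) ` S))) / real (card (cyclic_perms S))"

lemma mean_cycles_singleton:
  assumes "\<tau> permutes {x}"
  shows "mean_cycles {x} \<tau> = 1"
  using assms by (simp add: mean_cycles_def cyclic_perms_singleton)

text \<open>Condition on \<open>\<rho> x = y\<close> and delete \<open>x\<close> from
  \<open>\<tau> \<circ> \<rho>\<close>. A cycle is lost exactly when \<open>\<tau> y = x\<close>;
  the only such \<open>y\<close> is \<open>inv \<tau> x\<close>, which is a possible image of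
  \<open>x\<close> unless \<open>\<tau>\<close> fixes \<open>x\<close>.\<close>

lemma mean_cycles_rec:
  assumes fin: "finite S" and x: "x \<in> S" and ne: "S - {x} \<noteq> {}" and t: "\<tau> permutes S"
  shows "(real (card S) - 1) * mean_cycles S \<tau> =
    (\<Sum>y\<in>S - {x}. mean_cycles (S - {x}) (contract \<tau> x y)) +
    (if \<tau> x = x then 0 else 1)"
proof -
  let ?S = "S - {x}"
  let ?N = "real (card (cyclic_perms ?S))"
  let ?t = "\<lambda>y. contract \<tau> x y"
  have N: "?N > 0"
    using cyclic_perms_nonempty[of ?S] finite_cyclic_perms[of ?S] fin ne by (simp add: card_gt_0_iff)
  have cS: "card S \<ge> 2"
    using ne fin x by (metis One_nat_def Suc_1 Suc_leI card_Diff_singleton card_gt_0_iff finite_Diff zero_less_diff)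
  have M: "real (card (cyclic_perms S)) = (real (card S) - 1) * ?N"
    using card_cyclic_perms[OF fin x ne] cS by simp
  have count: "real (card (orbit (\<tau> \<circ> (Transposition.transpose x y \<circ> \<rho>)) ` S)) =
      real (card (orbit (?t y \<circ> \<rho>) ` ?S)) + (if \<tau> y = x then 1 else 0)"
    if y: "y \<in> ?S" and r: "\<rho> \<in> cyclic_perms ?S" for y \<rho>
  proof -
    let ?p = "\<tau> \<circ> (Transposition.transpose x y \<circ> \<rho>)"
    have rp: "\<rho> permutes ?S" using r by (simp add: cyclic_perms_def)
    then have rx: "\<rho> x = x" by (simp add: permutes_not_in)
    have p: "?p permutes S"
      using x y by (intro permutes_compose[OF _ t] permutes_compose[OF _ permutes_swap_id] permutes_subset[OF rp]) auto
    have "del_point x ?p = ?t y \<circ> \<rho>"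
      using del_point_comp[of \<rho> x "\<tau> \<circ> Transposition.transpose x y", OF rx] by (simp add: o_assoc)
    moreover have "?p x = \<tau> y" using rx by simp
    ultimately show ?thesis
      using card_orbits_eq_del_point[OF p fin x] by simp
  qed
  have last: "(\<Sum>y\<in>?S. if \<tau> y = x then 1 else (0::real)) = (if \<tau> x = x then 0 else 1)"
  proof -
    have "(\<Sum>y\<in>?S. if \<tau> y = x then 1 else (0::real)) = (\<Sum>y\<in>?S. if y = inv \<tau> x then 1 else 0)"
      using t by (intro sum.cong refl) (auto simp: permutes_inverses)
    also have "\<dots> = (if inv \<tau> x \<in> ?S then 1 else 0)" using fin by simp
    also have "inv \<tau> x \<in> ?S \<longleftrightarrow> \<tau> x \<noteq> x"
      using permutes_in_image[OF permutes_inv[OF t], of x] permutes_inv_eq[OF t, of x x] x by auto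
    finally show ?thesis by simp
  qed
  have "(\<Sum>\<rho>\<in>cyclic_perms S. real (card (orbit (\<tau> \<circ> \<rho>) ` S))) =
      (\<Sum>y\<in>?S. \<Sum>\<rho>\<in>cyclic_perms ?S. real (card (orbit (?t y \<circ> \<rho>) ` ?S)) + (if \<tau> y = x then 1 else 0))"
    by (rule trans[OF sum_cyclic_perms[OF x ne]]) (intro sum.cong refl count)
  also have "\<dots> = (\<Sum>y\<in>?S. ?N * mean_cycles ?S (?t y) + ?N * (if \<tau> y = x then 1 else 0))"
    using N by (intro sum.cong refl) (simp add: sum.distrib mean_cycles_def)
  also have "\<dots> = ?N * ((\<Sum>y\<in>?S. mean_cycles ?S (?t y)) + (if \<tau> x = x then 0 else 1))"
    by (simp only: sum.distrib sum_distrib_left[symmetric] last distrib_left)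
  finally show ?thesis
    unfolding mean_cycles_def[of S] M using N cS by (simp add: field_simps)
qed

section \<open>Cycle structure after contracting a point\<close>

text \<open>Cycles are written as lists so that joining and splitting become concatenation and
  cutting; \<open>rotate1\<close> says that each entry goes to its cyclic successor.\<close>

definition is_cycle :: "('b \<Rightarrow> 'b) \<Rightarrow> 'b list \<Rightarrow> bool" where
  "is_cycle p xs \<longleftrightarrow> xs \<noteq> [] \<and> distinct xs \<and> map p xs = rotate1 xs"

lemma is_cycle_nth:
  assumes "is_cycle p xs" "i < length xs"
  shows "p (xs ! i) = xs ! (Suc i mod length xs)"
proof -
  have "p (xs ! i) = map p xs ! i" using assms(2) by simp
  also have "\<dots> = rotate1 xs ! i" using assms(1) by (simp add: is_cycle_def)
  finally show ?thesis using assms(2) by (simp add: nth_rotate1)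
qed

lemma is_cycle_cyclic_on:
  assumes c: "is_cycle p xs"
  shows "cyclic_on p (set xs)"
proof -
  have ne: "length xs > 0" using c by (simp add: is_cycle_def)
  have pow: "(p ^^ n) (xs ! 0) = xs ! (n mod length xs)" for n
  proof (induction n)
    case (Suc n)
    then show ?case
      using is_cycle_nth[OF c, of "n mod length xs"] ne by (simp add: mod_Suc_eq)
  qed simp
  have "orbit p (xs ! 0) = set xs"
  proof (intro set_eqI iffI)
    fix y assume "y \<in> orbit p (xs ! 0)"
    then show "y \<in> set xs" using pow ne by (auto simp: orbit_altdef)
  next
    fix y assume "y \<in> set xs"
    then obtain i where i: "i < length xs" "y = xs ! i" by (auto simp: in_set_conv_nth)
    then have "(p ^^ (i + length xs)) (xs ! 0) = y" "0 < i + length xs" using pow ne by auto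
    then show "y \<in> orbit p (xs ! 0)" by (force simp: orbit_altdef)
  qed
  then show ?thesis using ne by (metis cyclic_on_singleI nth_mem)
qed

lemma is_cycle_snoc:
  "is_cycle p (xs @ [x]) \<longleftrightarrow>
     distinct (xs @ [x]) \<and> map p xs = tl (xs @ [x]) \<and> p x = hd (xs @ [x])"
  by (cases xs) (auto simp: is_cycle_def)

text \<open>The list starts at \<open>p x\<close>, so that the point \<open>x\<close> to be
  contracted stands at its end.\<close>

lemma orbit_is_cycle:
  assumes "x \<in> orbit p x"
  obtains xs where "is_cycle p (xs @ [x])" "set (xs @ [x]) = orbit p x"
proof -
  obtain n where pn: "(p ^^ Suc n) x = x" and inj: "inj_on (\<lambda>i. (p ^^ i) x) {0..<Suc n}"
    and orb: "orbit p x = (\<lambda>i. (p ^^ i) x) ` {0..<Suc n}"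
    using funpow_dist1_prop[OF assms] inj_on_funpow_dist1[OF assms] orbit_conv_funpow_dist1[OF assms]
    by blast
  let ?xs = "map (\<lambda>i. (p ^^ i) x) [1..<Suc n]"
  have split: "[0..<Suc n] = 0 # [1..<Suc n]" by (simp only: upt_conv_Cons zero_less_Suc One_nat_def)
  have "distinct (map (\<lambda>i. (p ^^ i) x) [0..<Suc n])"
    using inj by (simp only: distinct_map distinct_upt set_upt simp_thms)
  then have dist: "distinct (?xs @ [x])"
    unfolding split by auto
  have "set (map (\<lambda>i. (p ^^ i) x) [0..<Suc n]) = orbit p x"
    unfolding orb by (simp only: set_map set_upt)
  then have set: "set (?xs @ [x]) = orbit p x"
    unfolding split by auto
  have "map p (map (\<lambda>i. (p ^^ i) x) [0..<Suc n]) = map (\<lambda>i. (p ^^ i) x) [1..<Suc (Suc n)]"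
    by (simp add: map_Suc_upt[symmetric] del: upt_Suc)
  also have "[1..<Suc (Suc n)] = [1..<Suc n] @ [Suc n]" by simp
  finally have "p x # map p ?xs = ?xs @ [x]"
    unfolding split using pn by (simp del: upt_Suc funpow.simps)
  then have "p x = hd (?xs @ [x])" "map p ?xs = tl (?xs @ [x])"
    by (metis list.sel(1), metis list.sel(3))
  then show ?thesis using dist set that[of ?xs] by (simp only: is_cycle_snoc simp_thms)
qed

text \<open>Serves to identify the orbits of \<open>contract \<tau> x y\<close> once the pieces have
  been guessed.\<close>

lemma orbits_eq_partition:
  assumes "\<And>C. C \<in> P \<Longrightarrow> cyclic_on p C" "\<Union>P = S"
  shows "orbit p ` S = P"
proof (intro set_eqI iffI)
  fix C assume "C \<in> orbit p ` S"
  then obtain x D where "C = orbit p x" "x \<in> D" "D \<in> P" using assms(2) by blast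
  then show "C \<in> P" using assms(1) orbit_cyclic_eq3 by metis
next
  fix C assume C: "C \<in> P"
  then obtain x where x: "x \<in> C" "C = orbit p x" using assms(1) by (auto simp: cyclic_on_def)
  then show "C \<in> orbit p ` S" using C assms(2) by blast
qed

lemma del_transpose_apply:
  assumes "inj \<tau>" "y \<noteq> x" "s \<noteq> x"
  shows "contract \<tau> x y s =
    (if s = y then if \<tau> x = x then \<tau> y else \<tau> x else if \<tau> s = x then \<tau> y else \<tau> s)"
  using assms by (auto simp: del_point_def Transposition.transpose_def dest: injD)


text \<open>A transposition of points in different cycles merges them, here into
  \<open>xs @ [x] @ ys @ [y]\<close>, from which \<open>x\<close> is then deleted.\<close>

lemma is_cycle_join:
  assumes inj\<tau>: "inj \<tau>"
    and X: "is_cycle \<tau> (xs @ [x])" and Y: "is_cycle \<tau> (ys @ [y])"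
    and disj: "set (xs @ [x]) \<inter> set (ys @ [y]) = {}"
  shows "is_cycle (contract \<tau> x y) (xs @ ys @ [y])"
proof -
  let ?q = "contract \<tau> x y"
  have yx: "y \<noteq> x" using disj by auto
  note q = del_transpose_apply[OF inj\<tau> yx]
  have Y': "distinct (ys @ [y])" "map \<tau> ys = tl (ys @ [y])" "\<tau> y = hd (ys @ [y])"
    using Y by (auto simp: is_cycle_snoc)
  have inj: "\<tau> a = \<tau> b \<longleftrightarrow> a = b" for a b using inj\<tau> by (rule inj_eq)
  show ?thesis
  proof (cases xs rule: rev_cases)
    case Nil
    then have tx: "\<tau> x = x" using X unfolding is_cycle_snoc by simp
    have "?q s = \<tau> s" if "s \<in> set (ys @ [y])" for s
    proof -
      have "s \<noteq> x" using that disj by auto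
      then show ?thesis using q[of s] tx inj[of s x] by auto
    qed
    then have "map ?q (ys @ [y]) = map \<tau> (ys @ [y])" by (intro map_cong refl)
    then show ?thesis using Y Nil by (simp only: is_cycle_def append_Nil simp_thms)
  next
    case (snoc as u)
    have X': "distinct (as @ [u, x])" "map \<tau> as = tl (as @ [u])" "\<tau> u = x" "\<tau> x = hd (as @ [u])"
      using X unfolding snoc is_cycle_snoc by (cases as; simp)+
    have tx: "\<tau> x \<noteq> x" using X' inj[of u x] by auto
    \<comment> \<open>Only the two seams change: \<open>y\<close> leads back to the start of
      \<open>xs\<close>, and the predecessor \<open>u\<close> of \<open>x\<close> leads to the start
      of the other cycle.\<close>
    have ty: "?q y = \<tau> x" using q[of y] yx tx by simp
    have tu: "?q u = \<tau> y" using q[of u] X' disj snoc by auto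
    have eq: "?q s = \<tau> s" if "s \<in> set as \<union> set ys" for s
    proof -
      have "s \<noteq> x" "s \<noteq> y" "s \<noteq> u" using that X'(1) Y'(1) disj snoc by auto
      then show ?thesis using q[of s] inj[of s u] X'(3) by auto
    qed
    have "map ?q (xs @ ys) = map \<tau> as @ [\<tau> y] @ map \<tau> ys"
      using eq tu snoc by simp
    also have "\<dots> = tl (as @ [u]) @ ys @ [y]"
      unfolding X'(2) Y'(2,3) by (cases ys) auto
    also have "\<dots> = tl ((xs @ ys) @ [y])"
      using snoc by (cases as) auto
    finally have "map ?q (xs @ ys) = tl ((xs @ ys) @ [y])" .
    moreover have "?q y = hd ((xs @ ys) @ [y])"
      using ty X'(4) snoc by (cases as) auto
    moreover have "distinct ((xs @ ys) @ [y])"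
      using X'(1) Y'(1) disj snoc by auto
    ultimately have "is_cycle ?q ((xs @ ys) @ [y])" unfolding is_cycle_snoc by blast
    then show ?thesis by simp
  qed
qed

text \<open>A transposition of two points of one cycle cuts it, here into \<open>as @ [y]\<close>
  and \<open>bs @ [x]\<close>. Deleting \<open>x\<close> from the second piece leaves nothing if
  \<open>bs\<close> is empty.\<close>

lemma is_cycle_split:
  assumes inj\<tau>: "inj \<tau>"
    and X: "is_cycle \<tau> (as @ [y] @ bs @ [x])"
  shows "is_cycle (contract \<tau> x y) (as @ [y])"
    and "bs \<noteq> [] \<Longrightarrow> is_cycle (contract \<tau> x y) bs"
proof -
  let ?q = "contract \<tau> x y"
  have inj: "\<tau> a = \<tau> b \<longleftrightarrow> a = b" for a b using inj\<tau> by (rule inj_eq)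
  have X': "distinct (as @ [y] @ bs @ [x])" "map \<tau> (as @ [y] @ bs) = tl (as @ [y]) @ bs @ [x]"
    "\<tau> x = hd (as @ [y])"
    using X is_cycle_snoc[of \<tau> "as @ [y] @ bs" x] by (cases as; auto)+
  have yx: "y \<noteq> x" using X'(1) by auto
  note q = del_transpose_apply[OF inj\<tau> yx]
  have tx: "\<tau> x \<noteq> x" using X'(1,3) by (cases as) auto
  have ty: "?q y = \<tau> x" using q[of y] yx tx by simp
  have mas: "map \<tau> as = tl (as @ [y])" and mbs: "\<tau> y # map \<tau> bs = bs @ [x]"
    using X'(2) by (auto simp: append_eq_append_conv)
  have eqa: "?q s = \<tau> s" if "s \<in> set as" for s
  proof -
    have "s \<noteq> x" "s \<noteq> y" using that X'(1) by auto
    moreover have "\<tau> s \<in> set (tl (as @ [y]))" using that mas[symmetric] by simp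
    then have "\<tau> s \<noteq> x" using X'(1) by (cases as) auto
    ultimately show ?thesis using q[of s] by auto
  qed
  then have "map ?q as = tl (as @ [y])" using mas by (metis map_cong)
  then show "is_cycle ?q (as @ [y])"
    using ty X'(1,3) by (auto simp: is_cycle_snoc)
  assume ne: "bs \<noteq> []"
  then obtain cs u where bs: "bs = cs @ [u]" by (cases bs rule: rev_cases) auto
  have mbs': "\<tau> y = hd bs" "map \<tau> cs = tl bs" "\<tau> u = x"
    using mbs bs by (cases cs; auto)+
  have eqb: "?q s = \<tau> s" if "s \<in> set cs" for s
  proof -
    have "s \<noteq> x" "s \<noteq> y" "s \<noteq> u" using that X'(1) bs by auto
    then show ?thesis using q[of s] mbs'(3) inj[of s u] by auto
  qed
  then have "map ?q cs = tl (cs @ [u])" using mbs'(2) bs by (metis map_cong)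
  moreover have "?q u = hd (cs @ [u])"
    using q[of u] mbs'(1,3) bs X'(1) by auto
  ultimately show "is_cycle ?q bs"
    using X'(1) bs by (auto simp: is_cycle_snoc)
qed

section \<open>Products over cycles under contraction\<close>

definition orbit_prod :: "(nat \<Rightarrow> real) \<Rightarrow> 'b set \<Rightarrow> ('b \<Rightarrow> 'b) \<Rightarrow> real" where
  "orbit_prod g S p = (\<Prod>C\<in>orbit p ` S. g (card C))"

context
  fixes S :: "'b set" and \<tau> :: "'b \<Rightarrow> 'b"
  assumes fin: "finite S" and t: "\<tau> permutes S"
begin

lemma permutation_tau: "permutation \<tau>"
  using fin t by (auto simp: permutation_permutes)

lemma orbits_disjoint:
  "C \<in> orbit \<tau> ` S \<Longrightarrow> D \<in> orbit \<tau> ` S \<Longrightarrow> C \<noteq> D \<Longrightarrow> C \<inter> D = {}"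
  using orbit_eq_iff_mem[OF permutation_tau] by blast

lemma Union_orbits: "\<Union>(orbit \<tau> ` S) = S"
  using permutes_orbit_subset[OF t] permutation_self_in_orbit[OF permutation_tau] by blast

context
  fixes x :: 'b
  assumes x: "x \<in> S"
begin

lemma Union_other_orbits:
  "\<Union>(orbit \<tau> ` S - {orbit \<tau> x}) \<union> orbit \<tau> x = S"
proof -
  have "orbit \<tau> ` S = insert (orbit \<tau> x) (orbit \<tau> ` S - {orbit \<tau> x})" using x by blast
  then have "\<Union>(orbit \<tau> ` S) = orbit \<tau> x \<union> \<Union>(orbit \<tau> ` S - {orbit \<tau> x})"
    by (metis Union_insert)
  then show ?thesis unfolding Union_orbits by (simp add: Un_commute)
qed

text \<open>Apart from \<open>x\<close>, contraction changes \<open>\<tau>\<close> at most at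
  \<open>y\<close> and at the predecessor of \<open>x\<close>, and neither lies in
  \<open>C\<close>.\<close>

lemma cyclic_on_unaffected:
  assumes C: "C \<in> orbit \<tau> ` S" "x \<notin> C" "y \<notin> C"
  shows "cyclic_on (contract \<tau> x y) C"
proof -
  have cyc: "cyclic_on \<tau> C" using C(1) cyclic_on_orbit[OF t fin] by blast
  have "contract \<tau> x y s = \<tau> s" if s: "s \<in> C" for s
  proof -
    have "\<tau> s \<in> C" using cyc s by (rule cyclic_on_inI)
    moreover have "\<tau> y \<noteq> \<tau> s" using permutes_inj[OF t] s C by (auto dest: injD)
    ultimately show ?thesis using s C
      by (auto simp: del_point_def Transposition.transpose_def)
  qed
  then show ?thesis using cyc by (subst cyclic_cong[of C _ \<tau>]) auto
qed

lemma orbit_prod_join: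
  assumes C: "C \<in> orbit \<tau> ` S - {orbit \<tau> x}" and y: "y \<in> C"
  shows "orbit_prod g (S - {x}) (contract \<tau> x y) =
    g (card (orbit \<tau> x) - 1 + card C) * (\<Prod>D\<in>orbit \<tau> ` S - {orbit \<tau> x} - {C}. g (card D))"
proof -
  let ?q = "contract \<tau> x y"
  let ?O = "orbit \<tau> ` S" and ?X = "orbit \<tau> x"
  obtain xs where xs: "is_cycle \<tau> (xs @ [x])" "set (xs @ [x]) = ?X"
    using orbit_is_cycle permutation_self_in_orbit[OF permutation_tau] by metis
  have Cy: "C = orbit \<tau> y" using C y orbit_eq_iff_mem[OF permutation_tau] by auto
  obtain ys where ys: "is_cycle \<tau> (ys @ [y])" "set (ys @ [y]) = C"
    using orbit_is_cycle permutation_self_in_orbit[OF permutation_tau] unfolding Cy by metis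
  have X: "?X \<in> ?O" using x by blast
  have disj: "?X \<inter> C = {}" using orbits_disjoint[OF X] C by blast
  let ?Z = "set (xs @ ys @ [y])"
  let ?R = "?O - {?X} - {C}"
  have cz: "is_cycle ?q (xs @ ys @ [y])"
    using is_cycle_join[OF permutes_inj[OF t] xs(1) ys(1)] disj unfolding xs(2) ys(2) by blast
  have Z: "?Z = ?X - {x} \<union> C" using xs ys disj by (auto simp: is_cycle_def)
  have dR: "D \<inter> ?X = {}" "D \<inter> C = {}" if "D \<in> ?R" for D
    using that C orbits_disjoint[OF _ X, of D] orbits_disjoint[of D C] by (simp_all only: Diff_iff singleton_iff simp_thms)
  have "orbit ?q ` (S - {x}) = insert ?Z ?R"
  proof (rule orbits_eq_partition)
    fix D assume "D \<in> insert ?Z ?R"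
    then show "cyclic_on ?q D"
    proof
      assume D: "D \<in> ?R"
      have "x \<notin> D" "y \<notin> D"
        using dR(1,2)[OF D] y permutation_self_in_orbit[OF permutation_tau, of x] by (simp_all add: disjoint_iff) metis+
      moreover have "D \<in> ?O" using D by simp
      ultimately show ?thesis by (intro cyclic_on_unaffected)
    qed (use is_cycle_cyclic_on[OF cz] in simp)
  next
    have xX: "x \<in> ?X" by (rule permutation_self_in_orbit[OF permutation_tau])
    have gen: "A - {x} \<union> C \<union> U = S - {x}" if "S = C \<union> U \<union> A" "x \<notin> C" "x \<notin> U" for A U
      using that by auto
    have xR: "x \<notin> \<Union>?R" using dR(1) xX by blast
    have xC: "x \<notin> C" using disj xX by blast
    have "?O - {?X} = insert C ?R" using C by blast
    then have "\<Union>(?O - {?X}) = C \<union> \<Union>?R" by (metis Union_insert)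
    then have "S = C \<union> \<Union>?R \<union> ?X" using Union_other_orbits by simp
    then have "?X - {x} \<union> C \<union> \<Union>?R = S - {x}" using xC xR by (rule gen)
    then show "\<Union>(insert ?Z ?R) = S - {x}" unfolding Union_insert Z .
  qed
  moreover have "?Z \<notin> ?R" 
  proof
    assume "?Z \<in> ?R"
    then have "?Z \<inter> C = {}" by (rule dR(2))
    moreover have "y \<in> ?Z" by simp
    ultimately show False using y by blast
  qed
  moreover have "finite ?R" using fin by simp
  moreover have "card ?Z = card ?X - 1 + card C"
  proof -
    have "card ?Z = card (?X - {x}) + card C"
      unfolding Z using disj by (intro card_Un_disjoint) (auto simp flip: xs(2) ys(2))
    then show ?thesis by (simp add: card_Diff_singleton permutation_self_in_orbit[OF permutation_tau])
  qed
  ultimately show ?thesis by (simp add: orbit_prod_def)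
qed

lemma orbit_prod_split:
  assumes X: "is_cycle \<tau> (as @ [y] @ bs @ [x])"
  shows "orbit_prod g (S - {x}) (contract \<tau> x y) =
    g (length as + 1) * (if bs = [] then 1 else g (length bs)) * (\<Prod>D\<in>orbit \<tau> ` S - {orbit \<tau> x}. g (card D))"
proof -
  let ?q = "contract \<tau> x y"
  let ?O = "orbit \<tau> ` S" and ?X = "orbit \<tau> x"
  let ?A = "set (as @ [y])" and ?B = "if bs = [] then {} else {set bs}"
  let ?R = "?O - {?X}"
  have dist: "distinct (as @ [y] @ bs @ [x])" using X by (simp add: is_cycle_def)
  have sX: "?X = insert x (?A \<union> set bs)"
    using orbit_cyclic_eq3[OF is_cycle_cyclic_on[OF X], of x] by auto
  have XO: "?X \<in> ?O" using x by blast
  have dR: "D \<inter> ?X = {}" if "D \<in> ?R" for D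
    using that by (intro orbits_disjoint[OF _ XO]) auto
  have "orbit ?q ` (S - {x}) = insert ?A (?B \<union> ?R)"
  proof (rule orbits_eq_partition)
    fix D assume "D \<in> insert ?A (?B \<union> ?R)"
    then consider "D = ?A" | "bs \<noteq> []" "D = set bs" | "D \<in> ?R" by (auto split: if_splits)
    then show "cyclic_on ?q D"
    proof cases
      case 3
      then have "x \<notin> D" "y \<notin> D" using dR[OF 3] unfolding sX by auto
      moreover have "D \<in> ?O" using 3 by simp
      ultimately show ?thesis by (intro cyclic_on_unaffected)
    next
      case 1
      then show ?thesis using is_cycle_cyclic_on[OF is_cycle_split(1)[OF permutes_inj[OF t] X]] by simp
    next
      case 2
      then show ?thesis using is_cycle_cyclic_on[OF is_cycle_split(2)[OF permutes_inj[OF t] X]] by simp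
    qed
  next
    have gen: "A \<union> U = S - {x}" if "U \<union> insert x A = S" "x \<notin> A" "x \<notin> U" for A U
      using that by auto
    have xR: "x \<notin> \<Union>?R" using dR unfolding sX by auto
    have xA: "x \<notin> ?A \<union> set bs" using dist by auto
    have "\<Union>(insert ?A (?B \<union> ?R)) = ?A \<union> set bs \<union> \<Union>?R" by (simp add: Un_assoc)
    also have "\<dots> = S - {x}"
      unfolding sX by (rule gen[OF Union_other_orbits[unfolded sX] xA xR[unfolded sX]])
    finally show "\<Union>(insert ?A (?B \<union> ?R)) = S - {x}" .
  qed
  moreover have notR: "D \<notin> ?R" if "D \<subseteq> ?X" "D \<noteq> {}" for D
    using dR[of D] that by (metis inf.absorb1)
  have "?A \<notin> ?R" by (rule notR) (auto simp: sX)
  moreover have "?A \<notin> ?B" using dist by auto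
  moreover have "set bs \<notin> ?R" if "bs \<noteq> []" by (rule notR) (use that in \<open>auto simp: sX\<close>)
  moreover have "finite ?R" using fin by simp
  moreover have "card ?A = length as + 1" "card (set bs) = length bs"
    using dist by (auto simp: distinct_card)
  ultimately show ?thesis by (simp add: orbit_prod_def)
qed

text \<open>Group the points \<open>y\<close> by their cycle. Each of the \<open>card C\<close>
  points of another cycle \<open>C\<close> causes the same join. In the cycle of \<open>x\<close>,
  listed with \<open>x\<close> last, the entry at index \<open>i\<close> cuts off
  \<open>Suc i\<close> points and leaves \<open>card (orbit \<tau> x) - 1 - Suc i\<close>; an empty
  remainder counts as factor 1.\<close>

lemma sum_orbit_prod:
  "(\<Sum>y\<in>S - {x}. orbit_prod g (S - {x}) (contract \<tau> x y)) =
    (\<Sum>C\<in>orbit \<tau> ` S - {orbit \<tau> x}. real (card C) *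
       (g (card (orbit \<tau> x) - 1 + card C) * (\<Prod>D\<in>orbit \<tau> ` S - {orbit \<tau> x} - {C}. g (card D)))) +
    (\<Sum>i<card (orbit \<tau> x) - 1. g (Suc i) *
       (if card (orbit \<tau> x) - 1 - Suc i = 0 then 1 else g (card (orbit \<tau> x) - 1 - Suc i))) *
      (\<Prod>D\<in>orbit \<tau> ` S - {orbit \<tau> x}. g (card D))"
proof -
  let ?F = "\<lambda>y. orbit_prod g (S - {x}) (contract \<tau> x y)"
  let ?O = "orbit \<tau> ` S" and ?X = "orbit \<tau> x"
  let ?R = "?O - {?X}"
  have XO: "?X \<in> ?O" using x by blast
  have xX: "x \<in> ?X" by (rule permutation_self_in_orbit[OF permutation_tau])
  have finO: "finite C" if "C \<in> ?O" for C
    using that permutes_orbit_subset[OF t] fin by (auto intro: finite_subset)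
  have dX: "\<Union>?R \<inter> ?X = {}" using orbits_disjoint[OF _ XO] by auto
  have "S = \<Union>?R \<union> ?X"
    by (rule Union_other_orbits[symmetric])
  moreover have "S - {x} = U \<union> (?X - {x})" if "S = U \<union> ?X" "U \<inter> ?X = {}" for U
    using that xX by auto
  ultimately have "S - {x} = \<Union>?R \<union> (?X - {x})"
    using dX by blast
  then have "sum ?F (S - {x}) = sum ?F (\<Union>?R \<union> (?X - {x}))" by (rule arg_cong)
  also have "\<dots> = sum ?F (\<Union>?R) + sum ?F (?X - {x})"
  proof (rule sum.union_disjoint)
    show "finite (\<Union>?R)" using finO fin by blast
    show "finite (?X - {x})" using finO[OF XO] by simp
    show "\<Union>?R \<inter> (?X - {x}) = {}" using dX by blast
  qed
  also have "sum ?F (\<Union>?R) = (\<Sum>C\<in>?R. \<Sum>y\<in>C. ?F y)"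
  proof (rule trans[OF sum.Union_disjoint])
    show "\<forall>C\<in>?R. finite C" using finO by blast
    show "\<forall>C\<in>?R. \<forall>D\<in>?R. C \<noteq> D \<longrightarrow> C \<inter> D = {}" using orbits_disjoint by blast
  qed simp
  also have "\<dots> = (\<Sum>C\<in>?R. real (card C) * (g (card ?X - 1 + card C) * (\<Prod>D\<in>?R - {C}. g (card D))))"
    by (intro sum.cong refl) (simp add: orbit_prod_join)
  also have "sum ?F (?X - {x}) = (\<Sum>i<card ?X - 1. g (Suc i) *
       (if card ?X - 1 - Suc i = 0 then 1 else g (card ?X - 1 - Suc i)) * (\<Prod>D\<in>?R. g (card D)))"
  proof -
    obtain xs where xs: "is_cycle \<tau> (xs @ [x])" "set (xs @ [x]) = ?X"
      using orbit_is_cycle[OF xX] by blast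
    have dist: "distinct (xs @ [x])" using xs by (simp add: is_cycle_def)
    have "card (set (xs @ [x])) = length (xs @ [x])" using dist by (rule distinct_card)
    then have len: "length xs = card ?X - 1" using xs(2) by simp
    have "set xs = ?X - {x}" using xs(2) dist by auto
    then have "sum ?F (?X - {x}) = (\<Sum>i<length xs. ?F (xs ! i))"
      using sum.reindex_bij_betw[OF bij_betw_nth[of xs "{..<length xs}" "set xs"], of ?F] dist by simp
    also have "\<dots> = (\<Sum>i<length xs. g (Suc i) *
       (if card ?X - 1 - Suc i = 0 then 1 else g (card ?X - 1 - Suc i)) * (\<Prod>D\<in>?R. g (card D)))"
    proof (intro sum.cong refl)
      fix i assume i: "i \<in> {..<length xs}"
      then have sp: "xs @ [x] = take i xs @ [xs ! i] @ drop (Suc i) xs @ [x]"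
        using id_take_nth_drop[of i xs] by simp
      show "?F (xs ! i) = g (Suc i) *
         (if card ?X - 1 - Suc i = 0 then 1 else g (card ?X - 1 - Suc i)) * (\<Prod>D\<in>?R. g (card D))"
        using orbit_prod_split[OF xs(1)[unfolded sp], of g] i len
        by auto
    qed
    finally show ?thesis using len by simp
  qed
  finally show ?thesis unfolding sum_distrib_right .
qed

end

end

section \<open>The integrand\<close>

text \<open>With \<open>a = 1 - t\<close> and \<open>c = - t\<close> one has
  \<open>a - c = 1\<close>, so this is the Lucas sequence \<open>(a ^ k - c ^ k) / (a - c)\<close>;
  \<open>cycle_weight_add\<close> is its addition formula.\<close>

definition cycle_weight :: "nat \<Rightarrow> real \<Rightarrow> real" where
  "cycle_weight k t = (1 - t) ^ k - (- t) ^ k"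

lemma cycle_weight_0 [simp]: "cycle_weight 0 t = 0"
  and cycle_weight_1 [simp]: "cycle_weight (Suc 0) t = 1"
  by (simp_all add: cycle_weight_def)

lemma DERIV_cycle_weight: "(cycle_weight k has_real_derivative - (real k * cycle_weight (k - 1) t)) (at t)"
  unfolding cycle_weight_def by (auto intro!: derivative_eq_intros simp: algebra_simps)

lemma cycle_weight_add:
  "cycle_weight (m + Suc k) t = cycle_weight (Suc m) t * cycle_weight (Suc k) t + t * (1 - t) * cycle_weight m t * cycle_weight k t"
proof -
  obtain a c where ac: "a = 1 - t" "c = - t" "a = 1 + c" by simp
  have "a ^ (m + Suc k) - c ^ (m + Suc k) =
      (a ^ Suc m - c ^ Suc m) * (a ^ Suc k - c ^ Suc k) - a * c * (a ^ m - c ^ m) * (a ^ k - c ^ k)"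
    unfolding power_add power_Suc ac(3) by algebra
  then show ?thesis unfolding cycle_weight_def ac(1,2) by simp
qed

text \<open>Expanding a product gives \<open>a ^ m + c ^ m\<close> minus two mixed terms, and each
  mixed sum is geometric with value \<open>cycle_weight (Suc m) t\<close>, because
  \<open>a - c = 1\<close>.\<close>

lemma cycle_weight_convolution:
  "(\<Sum>i\<le>m. cycle_weight i t * cycle_weight (m - i) t) = real (Suc m) * ((1 - t) ^ m + (- t) ^ m) - 2 * cycle_weight (Suc m) t"
proof -
  let ?a = "1 - t" and ?c = "- t"
  have geo: "(\<Sum>i\<le>m. ?a ^ i * ?c ^ (m - i)) = cycle_weight (Suc m) t"
    using diff_power_eq_sum[of ?a m ?c] by (simp add: cycle_weight_def lessThan_Suc_atMost)
  have geo': "(\<Sum>i\<le>m. ?a ^ (m - i) * ?c ^ i) = cycle_weight (Suc m) t"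
    unfolding geo[symmetric] by (rule sum.reindex_bij_witness[of _ "\<lambda>i. m - i" "\<lambda>i. m - i"]) auto
  have "(\<Sum>i\<le>m. cycle_weight i t * cycle_weight (m - i) t) =
      (\<Sum>i\<le>m. (?a ^ m + ?c ^ m) - ?a ^ i * ?c ^ (m - i) - ?a ^ (m - i) * ?c ^ i)"
  proof (intro sum.cong refl)
    fix i assume "i \<in> {..m}"
    then have "?a ^ m = ?a ^ i * ?a ^ (m - i)" "?c ^ m = ?c ^ i * ?c ^ (m - i)"
      by (simp_all flip: power_add)
    then show "cycle_weight i t * cycle_weight (m - i) t = (?a ^ m + ?c ^ m) - ?a ^ i * ?c ^ (m - i) - ?a ^ (m - i) * ?c ^ i"
      unfolding cycle_weight_def by (simp only:) (simp add: algebra_simps)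
  qed
  also have "\<dots> = real (Suc m) * (?a ^ m + ?c ^ m) - 2 * cycle_weight (Suc m) t"
    by (simp add: sum_subtractf geo geo')
  finally show ?thesis .
qed

lemma cycle_weight_convolution_split:
  "(\<Sum>i<m. cycle_weight (Suc i) t * (if m - Suc i = 0 then 1 else cycle_weight (m - Suc i) t)) =
     real m * cycle_weight (Suc m) t + 2 * t * cycle_weight m t + t * (1 - t) * real m * cycle_weight (m - 1) t"
proof (cases m)
  case (Suc k)
  have "(\<Sum>i<m. cycle_weight (Suc i) t * (if m - Suc i = 0 then 1 else cycle_weight (m - Suc i) t)) =
      (\<Sum>i<k. cycle_weight (Suc i) t * cycle_weight (m - Suc i) t) + cycle_weight m t"
    \<comment> \<open>The last summand is the one with an empty remainder, where the factor is 1
      instead of \<open>cycle_weight 0 t = 0\<close>. The full convolution then differs from the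
      other summands only by two vanishing end terms.\<close>
    unfolding Suc sum.lessThan_Suc by (intro arg_cong2[of _ _ _ _ "(+)"] sum.cong) auto
  also have "(\<Sum>i<k. cycle_weight (Suc i) t * cycle_weight (m - Suc i) t) = (\<Sum>i\<le>m. cycle_weight i t * cycle_weight (m - i) t)"
    unfolding Suc sum.atMost_Suc_shift[of _ k] by (simp add: lessThan_Suc_atMost[symmetric])
  finally have eq: "(\<Sum>i<m. cycle_weight (Suc i) t * (if m - Suc i = 0 then 1 else cycle_weight (m - Suc i) t)) =
      real (Suc m) * ((1 - t) ^ m + (- t) ^ m) - 2 * cycle_weight (Suc m) t + cycle_weight m t"
    unfolding cycle_weight_convolution .
  obtain c where c: "t = - c" using minus_minus[of t] by metis
  define A C where "A = (1 + c) ^ k" and "C = c ^ k"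
  have f: "cycle_weight (Suc m) t = (1 + c)\<^sup>2 * A - c\<^sup>2 * C" "cycle_weight m t = (1 + c) * A - c * C" "cycle_weight (m - 1) t = A - C"
    "(1 - t) ^ m = (1 + c) * A" "(- t) ^ m = c * C"
    unfolding cycle_weight_def Suc c A_def C_def by (simp_all add: power2_eq_square)
  show ?thesis unfolding eq f unfolding Suc c
    by (simp add: power2_eq_square algebra_simps)
qed simp

lemma DERIV_prod_cycle_weight:
  assumes "finite R"
  shows "((\<lambda>t. \<Prod>D\<in>R. cycle_weight (k D) t) has_real_derivative
    - (\<Sum>C\<in>R. real (k C) * cycle_weight (k C - 1) t * (\<Prod>D\<in>R - {C}. cycle_weight (k D) t))) (at t)"
  by (rule has_field_derivative_prod[THEN DERIV_cong])
    (auto intro: DERIV_cycle_weight simp: sum_negf)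

text \<open>
  The right-hand side is \<open>t\<close> times the derivative of \<open>(1 - t)\<^sup>2 * cycle_weight m t * Rt\<close>.
\<close>

lemma cycle_weight_identity:
  assumes fin: "finite R" and pos: "\<And>C. C \<in> R \<Longrightarrow> k C > 0"
    and R: "Rt = (\<Prod>D\<in>R. cycle_weight (k D) t)"
    and R': "Rt' = - (\<Sum>C\<in>R. real (k C) * cycle_weight (k C - 1) t * (\<Prod>D\<in>R - {C}. cycle_weight (k D) t))"
  shows "(1 - t) * (real (m + (\<Sum>C\<in>R. k C)) * (cycle_weight (Suc m) t * Rt)
      - ((\<Sum>C\<in>R. real (k C) * (cycle_weight (m + k C) t * (\<Prod>D\<in>R - {C}. cycle_weight (k D) t)))
         + (\<Sum>i<m. cycle_weight (Suc i) t * (if m - Suc i = 0 then 1 else cycle_weight (m - Suc i) t)) * Rt))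
    = t * (- 2 * (1 - t) * cycle_weight m t * Rt - (1 - t)\<^sup>2 * (real m * cycle_weight (m - 1) t) * Rt
           + (1 - t)\<^sup>2 * cycle_weight m t * Rt')"
proof -
  let ?P = "\<lambda>C. \<Prod>D\<in>R - {C}. cycle_weight (k D) t"
  \<comment> \<open>The addition formula splits each join: one part restores the full product
    \<open>Rt\<close>, the other is a summand of its derivative \<open>Rt'\<close>.\<close>
  have "(\<Sum>C\<in>R. real (k C) * (cycle_weight (m + k C) t * ?P C)) =
      (\<Sum>C\<in>R. real (k C) * (cycle_weight (Suc m) t * Rt) + t * (1 - t) * cycle_weight m t * (real (k C) * cycle_weight (k C - 1) t * ?P C))"
  proof (intro sum.cong refl)
    fix C assume C: "C \<in> R"
    then obtain j where j: "k C = Suc j" using pos[OF C] by (cases "k C") auto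
    have "Rt = cycle_weight (Suc j) t * ?P C" unfolding R using prod.remove[OF fin C, of "\<lambda>D. cycle_weight (k D) t"] j by simp
    then show "real (k C) * (cycle_weight (m + k C) t * ?P C) =
      real (k C) * (cycle_weight (Suc m) t * Rt) + t * (1 - t) * cycle_weight m t * (real (k C) * cycle_weight (k C - 1) t * ?P C)"
      unfolding j cycle_weight_add by (simp add: algebra_simps)
  qed
  also have "\<dots> = real (\<Sum>C\<in>R. k C) * (cycle_weight (Suc m) t * Rt) - t * (1 - t) * cycle_weight m t * Rt'"
    unfolding R' by (simp add: sum.distrib sum_distrib_left sum_distrib_right)
  finally have eq: "(\<Sum>C\<in>R. real (k C) * (cycle_weight (m + k C) t * ?P C)) =
    real (\<Sum>C\<in>R. k C) * (cycle_weight (Suc m) t * Rt) - t * (1 - t) * cycle_weight m t * Rt'" .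
  \<comment> \<open>The multiples of \<open>cycle_weight (Suc m) t * Rt\<close> cancel, and all that
    survives carries a factor \<open>t\<close>.\<close>
  show ?thesis
    unfolding cycle_weight_convolution_split eq of_nat_add by (simp only: power2_eq_square) algebra
qed

text \<open>For the products in use \<open>F 0 = 1\<close>, so the singularity at
  \<open>t = 0\<close> is removable. The value 0 that division by zero assigns there is wrong only
  at a single point.\<close>

definition face_integrand :: "(real \<Rightarrow> real) \<Rightarrow> real \<Rightarrow> real" where
  "face_integrand F t = (1 - (1 - t) * F t) / t"

text \<open>The substitution \<open>t = (1 - z\<^sup>2) / 2\<close>, after folding the interval at \<open>t = 1 / 2\<close>.\<close>

definition folded :: "(real \<Rightarrow> real) \<Rightarrow> real \<Rightarrow> real" where
  "folded G z = z * (G ((1 - z\<^sup>2) / 2) + G ((1 + z\<^sup>2) / 2))"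

lemma has_integral_folded_deriv:
  assumes "\<And>t. (D has_real_derivative D' t) (at t)"
  shows "(folded D' has_integral (D 1 - D 0)) {0..1}"
proof -
  \<comment> \<open>The increment of \<open>D\<close> over the interval of radius
    \<open>z^2 / 2\<close> about \<open>1 / 2\<close>; it is 0 at \<open>z = 0\<close>, and at
    \<open>z = 1\<close> the interval is all of \<open>[0, 1]\<close>.\<close>
  let ?E = "\<lambda>z. D ((1 + z\<^sup>2) / 2) - D ((1 - z\<^sup>2) / 2)"
  have "(?E has_real_derivative folded D' z) (at z within {0..1})" for z
  proof -
    have *: "((\<lambda>z. D (f z)) has_real_derivative D' (f z) * f') (at z)"
      if "(f has_real_derivative f') (at z)" for f :: "real \<Rightarrow> real" and f'
      using DERIV_chain2[OF assms that] .
    have "(?E has_real_derivative D' ((1 + z\<^sup>2) / 2) * z - D' ((1 - z\<^sup>2) / 2) * (- z)) (at z)"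
      by (intro DERIV_diff *) (auto intro!: derivative_eq_intros)
    then show ?thesis
      by (rule DERIV_cong[OF has_field_derivative_at_within]) (simp add: folded_def algebra_simps)
  qed
  then have "(folded D' has_integral (?E 1 - ?E 0)) {0..1}"
    by (intro fundamental_theorem_of_calculus) (auto simp: has_real_derivative_iff_has_vector_derivative)
  then show ?thesis by simp
qed

lemma cycle_weight_at_0: "k > 0 \<Longrightarrow> cycle_weight k 0 = 1"
  by (cases k) (auto simp: cycle_weight_def)

lemma folded_points_nonzero:
  assumes "z \<in> {0..1} - {1::real}"
  shows "(1 - z\<^sup>2) / 2 \<noteq> 0" "(1 + z\<^sup>2) / 2 \<noteq> 0"
proof -
  have z: "z\<^sup>2 < 1" "0 \<le> z\<^sup>2" using assms by (auto simp: power_less_one_iff abs_square_less_1)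
  show "(1 - z\<^sup>2) / 2 \<noteq> 0" using z by simp
  have "0 < (1 + z\<^sup>2) / 2" using z(2) by (simp add: add_pos_nonneg)
  then show "(1 + z\<^sup>2) / 2 \<noteq> 0" by (rule less_imp_neq[symmetric])
qed

section \<open>The mean number of cycles\<close>

text \<open>Induction along \<open>mean_cycles_rec\<close>: the integrand for \<open>\<tau>\<close>
  is the average of those for its contractions, up to an exact derivative whose boundary values
  account for the extra summand of the recursion.\<close>

theorem mean_cycles_has_integral:
  assumes "finite S" "S \<noteq> {}" "\<tau> permutes S"
  shows "(folded (face_integrand (\<lambda>t. orbit_prod (\<lambda>k. cycle_weight k t) S \<tau>)) has_integral mean_cycles S \<tau>) {0..1}"
  using assms
proof (induction "card S" arbitrary: S \<tau> rule: less_induct)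
  case less
  let ?F = "\<lambda>S \<tau>. face_integrand (\<lambda>t. orbit_prod (\<lambda>k. cycle_weight k t) S \<tau>)"
  obtain x where x: "x \<in> S" using less by auto
  note fin = less(2) and t = less(4)
  note perm = permutation_tau[OF fin t]
  have fin1: "finite {1::real}" by simp
  show ?case
  proof (cases "S - {x} = {}")
    case True
    then have S: "S = {x}" using x by blast
    have o: "orbit \<tau> x = {x}" using t unfolding S by (simp add: orbit_eq_singleton_iff)
    have "((\<lambda>z::real. 2 * z) has_integral (1\<^sup>2 - 0\<^sup>2)) {0..1}"
      by (intro fundamental_theorem_of_calculus)
         (auto intro!: derivative_eq_intros simp: has_real_derivative_iff_has_vector_derivative[symmetric])
    then have int: "((\<lambda>z::real. 2 * z) has_integral mean_cycles S \<tau>) {0..1}"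
      using mean_cycles_singleton[of \<tau> x] t S by simp
    have eq: "folded (?F S \<tau>) z = 2 * z" if "z \<in> {0..1} - {1}" for z
    proof -
      have "z\<^sup>2 < 1" using that by (simp add: power_less_one_iff abs_square_less_1)
      moreover have "1 + z\<^sup>2 \<noteq> 0" by (smt (verit) zero_le_power2)
      ultimately show ?thesis
        by (simp add: folded_def face_integrand_def orbit_prod_def S o)
    qed
    show ?thesis by (rule has_integral_spike_finite[OF fin1 eq int])
  next
    case ne: False
    let ?S = "S - {x}" and ?O = "orbit \<tau> ` S" and ?X = "orbit \<tau> x"
    let ?R = "?O - {?X}"
    let ?t = "\<lambda>y. contract \<tau> x y"
    define m where "m = card ?X - 1"
    define n where "n = real (card S) - 1"
    have xX: "x \<in> ?X" by (rule permutation_self_in_orbit[OF perm])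
    have Xsub: "?X \<subseteq> S" using permutes_orbit_subset[OF t x] .
    have finX: "finite ?X" using Xsub fin by (rule finite_subset)
    have cX: "card ?X = Suc m" unfolding m_def using xX finX by (metis Suc_pred' card_gt_0_iff empty_iff)
    have finR: "finite ?R" using fin by simp
    have finC: "finite C" if "C \<in> ?R" for C
    proof -
      have "C \<subseteq> S" using that permutes_orbit_subset[OF t] by blast
      then show ?thesis using fin by (rule finite_subset)
    qed
    have pos: "card C > 0" if "C \<in> ?R" for C
      using that finC[OF that] orbit_nonempty[of \<tau>] by (auto simp: card_gt_0_iff)
    have XO: "?X \<in> ?O" using x by blast
    have "card S = card (\<Union>?R \<union> ?X)"
      using Union_other_orbits[OF fin t x] by (rule arg_cong[OF sym])
    also have "\<dots> = card (\<Union>?R) + card ?X"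
    proof (rule card_Un_disjoint)
      show "\<Union>?R \<inter> ?X = {}" using orbits_disjoint[OF fin t _ XO] by auto
      show "finite (\<Union>?R)" using finC by (rule finite_Union[OF finR])
    qed (rule finX)
    also have "card (\<Union>?R) = (\<Sum>C\<in>?R. card C)"
    proof (rule card_Union_disjoint)
      show "pairwise disjnt ?R"
        unfolding pairwise_def disjnt_def using orbits_disjoint[OF fin t] by simp
    qed (rule finC)
    finally have n: "n = real (m + (\<Sum>C\<in>?R. card C))" unfolding n_def cX by simp
    have c2: "card S \<ge> 2"
      using ne fin x by (metis One_nat_def Suc_1 Suc_leI card_Diff_singleton card_gt_0_iff finite_Diff zero_less_diff)
    then have n0: "n > 0" unfolding n_def by simp
    define Q where "Q t = (\<Prod>D\<in>?R. cycle_weight (card D) t)" for t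
    define Q' where "Q' t = - (\<Sum>C\<in>?R. real (card C) * cycle_weight (card C - 1) t * (\<Prod>D\<in>?R - {C}. cycle_weight (card D) t))" for t
    \<comment> \<open>At \<open>t = 1\<close> this vanishes, and at \<open>t = 0\<close> it is 1 or
      0 according to whether \<open>m > 0\<close>, that is, whether \<open>\<tau>\<close> moves
      \<open>x\<close>.\<close>
    define D where "D t = (1 - t)\<^sup>2 * cycle_weight m t * Q t" for t
    define D' where "D' t = - 2 * (1 - t) * cycle_weight m t * Q t - (1 - t)\<^sup>2 * (real m * cycle_weight (m - 1) t) * Q t
           + (1 - t)\<^sup>2 * cycle_weight m t * Q' t" for t
    have DQ: "(Q has_real_derivative Q' t) (at t)" for t
      unfolding Q_def Q'_def by (rule DERIV_prod_cycle_weight[OF finR])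
    have "(D has_real_derivative D' t) (at t)" for t
      unfolding D_def D'_def
      by (rule derivative_eq_intros DERIV_cycle_weight DQ refl | simp)+ (simp add: algebra_simps power2_eq_square)
    then have "(folded D' has_integral (D 1 - D 0)) {0..1}"
      by (rule has_integral_folded_deriv)
    moreover have "D 1 - D 0 = - (if \<tau> x = x then 0 else 1)"
    proof -
      have "\<tau> x = x \<longleftrightarrow> m = 0"
      proof
        assume "\<tau> x = x"
        then have "card ?X = 1" by (simp add: orbit_eq_singleton_iff[THEN iffD2])
        then show "m = 0" using cX by simp
      next
        assume "m = 0"
        then have "card ?X = 1" using cX by simp
        then have "?X = {x}" using xX by (metis card_1_singletonE singletonD)
        then show "\<tau> x = x" by (simp add: orbit_eq_singleton_iff)
      qed
      moreover have "Q 0 = 1" unfolding Q_def using pos by (intro prod.neutral) (simp add: cycle_weight_at_0)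
      ultimately show ?thesis unfolding D_def by (auto simp: cycle_weight_at_0)
    qed
    ultimately have iD: "(folded D' has_integral (- (if \<tau> x = x then 0 else 1))) {0..1}" by simp
    have iy: "(folded (?F ?S (?t y)) has_integral mean_cycles ?S (?t y)) {0..1}" if y: "y \<in> ?S" for y
    proof (rule less.hyps)
      show "card ?S < card S" using fin x by (rule card_Diff1_less)
      show "?t y permutes ?S"
        using y x by (intro del_point_permutes permutes_compose[OF permutes_swap_id t]) auto
    qed (use fin ne in auto)
    have eq: "?F S \<tau> s = ((\<Sum>y\<in>?S. ?F ?S (?t y) s) - D' s) / n" if s: "s \<noteq> 0" for s
    proof -
      let ?P = "\<Sum>y\<in>?S. orbit_prod (\<lambda>k. cycle_weight k s) ?S (?t y)"
      have P: "orbit_prod (\<lambda>k. cycle_weight k s) S \<tau> = cycle_weight (Suc m) s * Q s"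
        unfolding orbit_prod_def Q_def using prod.remove[of ?O ?X "\<lambda>C. cycle_weight (card C) s"] fin XO cX by simp
      have id: "(1 - s) * (n * (cycle_weight (Suc m) s * Q s) - ?P) = s * D' s"
        unfolding n D'_def
        using cycle_weight_identity[OF finR pos Q_def Q'_def, of s m]
        unfolding sum_orbit_prod[OF fin t x, of "\<lambda>k. cycle_weight k s"] cX Q_def[symmetric] diff_Suc_1 .
      have "(\<Sum>y\<in>?S. ?F ?S (?t y) s) = (real (card ?S) - (1 - s) * ?P) / s"
        unfolding face_integrand_def by (simp add: sum_divide_distrib[symmetric] sum_subtractf sum_distrib_left)
      also have "real (card ?S) = n" unfolding n_def using fin x c2 by (simp add: card_Diff_singleton of_nat_diff)
      finally have sy: "(\<Sum>y\<in>?S. ?F ?S (?t y) s) = (n - (1 - s) * ?P) / s" .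
      have "D' s = (1 - s) * (n * (cycle_weight (Suc m) s * Q s) - ?P) / s" using id s by (simp add: field_simps)
      moreover have "(n - (1 - s) * A) / s - (1 - s) * (n * B - A) / s = n * ((1 - (1 - s) * B) / s)" for A B
        using s by (simp add: field_simps)
      ultimately have "(\<Sum>y\<in>?S. ?F ?S (?t y) s) - D' s = n * ?F S \<tau> s"
        unfolding sy unfolding face_integrand_def P by simp
      then show ?thesis using n0 by simp
    qed
    have eqz: "folded (?F S \<tau>) z = ((\<Sum>y\<in>?S. folded (?F ?S (?t y)) z) - folded D' z) / n"
      if "z \<in> {0..1} - {1}" for z
    proof -
      note * = folded_points_nonzero[OF that]
      show ?thesis unfolding folded_def eq[OF *(1)] eq[OF *(2)] using n0
        by (simp add: sum_distrib_left[symmetric] sum.distrib field_simps)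
    qed
    have "((\<lambda>z. ((\<Sum>y\<in>?S. folded (?F ?S (?t y)) z) - folded D' z) / n) has_integral
        ((\<Sum>y\<in>?S. mean_cycles ?S (?t y)) - (- (if \<tau> x = x then 0 else 1))) / n) {0..1}"
      using fin by (intro has_integral_divide has_integral_diff has_integral_sum iy iD) auto
    moreover have "((\<Sum>y\<in>?S. mean_cycles ?S (?t y)) - (- (if \<tau> x = x then 0 else 1))) / n = mean_cycles S \<tau>"
      using mean_cycles_rec[OF fin x ne t] n0 unfolding n_def by (simp add: field_simps)
    ultimately have int: "((\<lambda>z. ((\<Sum>y\<in>?S. folded (?F ?S (?t y)) z) - folded D' z) / n)
        has_integral mean_cycles S \<tau>) {0..1}" by (simp only:)
    \<comment> \<open>The point \<open>z = 1\<close> is exempt, since there one of the folded points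
      is \<open>t = 0\<close>.\<close>
    show ?thesis by (rule has_integral_spike_finite[OF fin1 eqz int])
  qed
qed

section \<open>Bounding the integral\<close>

text \<open>The map \<open>t \<mapsto> 1 - t\<close> exchanges the bases \<open>1 - t\<close> and
  \<open>- t\<close> up to sign. Hence folding at \<open>1 / 2\<close> compares values of equal
  modulus.\<close>

lemma cycle_weight_reflect: "cycle_weight k (1 - t) = - ((-1) ^ k * cycle_weight k t)"
proof -
  have "cycle_weight k (1 - t) = t ^ k - (- (1 - t)) ^ k" by (simp add: cycle_weight_def)
  also have "\<dots> = (-1) ^ k * (- t) ^ k - (-1) ^ k * (1 - t) ^ k"
    by (simp flip: power_mult_distrib)
  finally show ?thesis by (simp add: cycle_weight_def algebra_simps)
qed

text \<open>For \<open>k = 2\<close> this is Pythagoras; a larger \<open>k\<close> follows because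
  both legs are at most the hypotenuse.\<close>

lemma power_superadditive:
  fixes a b z :: real
  assumes "0 \<le> b" "0 \<le> z" "0 \<le> a" "a\<^sup>2 = b\<^sup>2 + z\<^sup>2" "k \<ge> 2"
  shows "b ^ k + z ^ k \<le> a ^ k"
  using assms(5)
proof (induction k rule: dec_induct)
  case base
  then show ?case using assms by simp
next
  case (step k)
  have "b \<le> a" "z \<le> a" using assms by (auto intro: power2_le_imp_le)
  then have "b ^ Suc k + z ^ Suc k \<le> a * b ^ k + a * z ^ k"
    using assms by (simp add: mult_right_mono add_mono)
  also have "\<dots> \<le> a * a ^ k" using step.IH assms by (simp add: mult_left_mono flip: distrib_left)
  finally show ?case by simp
qed

text \<open>\<open>(1 - z^2) / 2\<close>, \<open>z\<close> and \<open>(1 + z^2) / 2\<close> are the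
  sides of a right triangle, so \<open>power_superadditive\<close> applies for
  \<open>k \<ge> 2\<close>. For \<open>k = 1\<close> the weight is 1.\<close>

lemma cycle_weight_lower:
  assumes z: "0 \<le> z" "z \<le> 1" and k: "k > 0"
  shows "z ^ k \<le> cycle_weight k ((1 - z\<^sup>2) / 2)"
proof (cases "k = 1")
  case True
  then show ?thesis using z by simp
next
  case False
  let ?a = "(1 + z\<^sup>2) / 2" and ?b = "(1 - z\<^sup>2) / 2"
  have z2: "0 \<le> z\<^sup>2" "z\<^sup>2 \<le> 1" using z by (auto simp: power_le_one)
  have sq: "?a\<^sup>2 = ?b\<^sup>2 + z\<^sup>2" by (simp add: power2_eq_square field_simps)
  have "?b ^ k + z ^ k \<le> ?a ^ k"
    by (rule power_superadditive) (use z z2 k False sq in auto)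
  moreover have "(- x) ^ k \<le> x ^ k" if "0 \<le> x" for x :: real
    using abs_ge_self[of "(- x) ^ k"] that by (simp add: power_abs)
  then have "(- ?b) ^ k \<le> ?b ^ k" using z2 by (metis diff_ge_0_iff_ge divide_nonneg_pos zero_less_numeral)
  moreover have ab: "1 - ?b = ?a" by (simp add: field_simps)
  have "cycle_weight k ?b = ?a ^ k - (- ?b) ^ k" unfolding cycle_weight_def ab ..
  ultimately show ?thesis by linarith
qed

section \<open>Upper bounds in terms of the cycle lengths alone\<close>

context
  fixes R :: "'c set" and k :: "'c \<Rightarrow> nat" and d :: nat and I :: real
  assumes fin: "finite R" and pos: "\<And>C. C \<in> R \<Longrightarrow> k C > 0" and sum_k: "(\<Sum>C\<in>R. k C) = d"
    and int: "(folded (face_integrand (\<lambda>t. \<Prod>C\<in>R. cycle_weight (k C) t)) has_integral I) {0..1}"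
begin

text \<open>The two folded points \<open>a\<close> and \<open>b\<close> have products of equal
  modulus, and the worst case has opposite signs. The resulting bound
  \<open>(1 - z^2 * P) / (a * b)\<close> decreases in \<open>P\<close>, and \<open>P\<close> is at
  least \<open>z ^ d\<close>.\<close>

lemma folded_upper:
  assumes z: "0 < z" "z < 1"
  shows "folded (face_integrand (\<lambda>t. \<Prod>C\<in>R. cycle_weight (k C) t)) z \<le> 4 * z * (1 - z ^ (d + 2)) / (1 - z ^ 4)"
proof -
  let ?F = "\<lambda>t. \<Prod>C\<in>R. cycle_weight (k C) t"
  define a b where "a = (1 + z\<^sup>2) / 2" and "b = (1 - z\<^sup>2) / 2"
  define P where "P = ?F b"
  have "z\<^sup>2 < 1" using z by (simp add: power_less_one_iff)
  then have ab: "0 < a" "0 < b" "a = 1 - b" "a + b = 1" "a\<^sup>2 - b\<^sup>2 = z\<^sup>2" "a * b = (1 - z ^ 4) / 4"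
    unfolding a_def b_def by (auto simp: add_pos_nonneg power2_eq_square power4_eq_xxxx field_simps)
  have "z ^ d \<le> P"
    unfolding P_def sum_k[symmetric] power_sum b_def
    using z pos by (intro prod_mono) (auto intro: cycle_weight_lower)
  moreover have "\<bar>?F a\<bar> = \<bar>P\<bar>"
    unfolding P_def ab(3) by (simp add: abs_prod cycle_weight_reflect abs_mult power_abs)
  ultimately have P: "z ^ d \<le> P" "- P \<le> ?F a" using z by (auto simp: abs_if zero_le_power split: if_splits)
    (smt (verit) zero_le_power)+
  have ab': "1 - b = a" "1 - a = b" using ab by auto
  have "face_integrand ?F b + face_integrand ?F a = (1 - a * P) / b + (1 - b * ?F a) / a"
    unfolding face_integrand_def P_def ab' ..
  also have "\<dots> \<le> (1 - a * P) / b + (1 + b * P) / a"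
    using mult_left_mono[OF P(2), of b] ab(1,2) by (intro add_left_mono divide_right_mono) auto
  also have "\<dots> = ((a + b) - (a\<^sup>2 - b\<^sup>2) * P) / (a * b)"
    using ab(1,2) by (simp add: field_simps power2_eq_square)
  also have "\<dots> = (1 - z\<^sup>2 * P) / (a * b)" unfolding ab(4,5) ..
  also have "\<dots> \<le> (1 - z\<^sup>2 * z ^ d) / (a * b)"
    using P(1) ab(1,2) by (intro divide_right_mono diff_left_mono mult_left_mono) auto
  finally have "folded (face_integrand ?F) z \<le> z * ((1 - z\<^sup>2 * z ^ d) / (a * b))"
    unfolding folded_def a_def[symmetric] b_def[symmetric] using z by (intro mult_left_mono) auto
  also have "\<dots> = 4 * z * (1 - z ^ (d + 2)) / (1 - z ^ 4)"
    unfolding ab(6) by (simp add: power_add power2_eq_square mult_ac)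
  finally show ?thesis .
qed

text \<open>The dominating function starts from \<open>4 z / (1 - z^4) = 1 / (1 - z) - 1 / (1 + z) +
  2 z / (1 + z^2)\<close>, with the geometric series of \<open>1 / (1 - z)\<close> cut after
  \<open>e\<close> terms. The cut series integrates to \<open>harm e\<close>, and the two logarithms
  cancel at \<open>z = 1\<close>.\<close>

lemma integral_upper:
  assumes d: "d \<ge> 2"
  shows "I \<le> harm (d - 1) + 5 / 4 * (1 / d + 1 / (d + 1))"
proof -
  define e where "e = d - 1"
  have de: "d = Suc e" "e > 0" using d unfolding e_def by auto
  \<comment> \<open>\<open>5 / 4 * (1 + z)\<close> is the tangent at \<open>1\<close> of \<open>(1 + 2 z + 3 z\<^sup>2 + 4 z\<^sup>3) / ((1 + z) (1 + z\<^sup>2))\<close>, which is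
    the factor of \<open>z\<^bsup>e\<^esup>\<close> in the bound of \<open>folded_upper\<close> once the other terms of \<open>?r\<close> are split off.\<close>
  let ?r = "\<lambda>z::real. (\<Sum>j<e. z ^ j) - 1 / (1 + z) + 2 * z / (1 + z\<^sup>2) + 5 / 4 * (z ^ e + z ^ Suc e)"
  let ?A = "\<lambda>z::real. (\<Sum>j<e. z ^ Suc j / Suc j) - ln (1 + z) + ln (1 + z\<^sup>2) +
    5 / 4 * (z ^ Suc e / Suc e + z ^ Suc (Suc e) / Suc (Suc e))"
  have "(?r has_integral (?A 1 - ?A 0)) {0..1}"
  proof (rule fundamental_theorem_of_calculus)
    fix z :: real assume z: "z \<in> {0..1}"
    have pos: "1 + z > 0" "1 + z\<^sup>2 > 0" using z by (auto simp: add_pos_nonneg)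
    have pw: "((\<lambda>z. z ^ Suc j / Suc j) has_real_derivative z ^ j) (at z)" for j
      by (rule DERIV_cong[OF DERIV_cdivide[OF DERIV_pow]]) (simp del: of_nat_Suc)
    have "(?A has_real_derivative ?r z) (at z)"
      by (intro DERIV_add DERIV_diff DERIV_sum DERIV_cmult pw)
         (use pos in \<open>auto intro!: derivative_eq_intros\<close>)
    then show "(?A has_vector_derivative ?r z) (at z within {0..1})"
      by (simp add: has_real_derivative_iff_has_vector_derivative has_vector_derivative_at_within)
  qed simp
  also have "?A 1 - ?A 0 = harm e + 5 / 4 * (1 / Suc e + 1 / (Suc e + 1))"
    by (simp add: harm_altdef inverse_eq_divide)
  finally have r: "(?r has_integral harm e + 5 / 4 * (1 / Suc e + 1 / (Suc e + 1))) {0..1}" .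
  have "I \<le> harm e + 5 / 4 * (1 / Suc e + 1 / (Suc e + 1))"
  proof (rule has_integral_le[OF int r])
    fix z :: real assume "z \<in> {0..1}"
    then consider "z = 0" | "z = 1" | "0 < z" "z < 1" by fastforce
    then show "folded (face_integrand (\<lambda>t. \<Prod>C\<in>R. cycle_weight (k C) t)) z \<le> ?r z"
    proof cases
      case 1
      have "(\<Sum>j<e. (0::real) ^ j) = 1" using de by (cases e) (auto simp: sum.lessThan_Suc_shift simp del: sum.lessThan_Suc)
      then show ?thesis using 1 de by (simp add: folded_def)
    next
      \<comment> \<open>Here the folded points are 0 and 1: the first contributes 0 through division
        by zero, the second contributes 1.\<close>
      case 2
      then show ?thesis using de by (simp add: folded_def face_integrand_def)
    next
      case 3
      define w where "w = z ^ e"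
      have w: "0 \<le> w" using 3 by (simp add: w_def)
      have z4: "1 - z ^ 4 = (1 - z) * ((1 + z) * (1 + z\<^sup>2))" by algebra
      have p: "1 - z > 0" "1 + z > 0" "1 + z\<^sup>2 > 0" using 3 by (auto simp: add_pos_nonneg)
      then have z4p: "1 - z ^ 4 > 0" unfolding z4 by simp
      have geo: "(\<Sum>j<e. z ^ j) = (1 - w) / (1 - z)"
        using one_diff_power_eq[of z e] p by (simp add: w_def field_simps)
      \<comment> \<open>Two of the three factors \<open>1 - z\<close> come from the tangency at 1,
        the third from \<open>1 - z ^ 4\<close>.\<close>
      have "?r z * (1 - z ^ 4) - 4 * z * (1 - z ^ 3 * w) = w * (1 - z) ^ 3 * (1 / 4 + z + 5 / 4 * z\<^sup>2)"
      proof -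
        have "(1 - w) / (1 - z) * (1 - z ^ 4) = (1 - w) * ((1 + z) * (1 + z\<^sup>2))"
          "1 / (1 + z) * (1 - z ^ 4) = (1 - z) * (1 + z\<^sup>2)"
          "2 * z / (1 + z\<^sup>2) * (1 - z ^ 4) = 2 * z * ((1 - z) * (1 + z))"
          unfolding z4 using p by simp_all
        then have eq: "?r z * (1 - z ^ 4) = (1 - w) * ((1 + z) * (1 + z\<^sup>2)) - (1 - z) * (1 + z\<^sup>2)
            + 2 * z * ((1 - z) * (1 + z)) + 5 / 4 * (w + z * w) * (1 - z ^ 4)"
          unfolding geo power_Suc w_def[symmetric] distrib_right[of _ _ "1 - z ^ 4"] left_diff_distrib[of _ _ "1 - z ^ 4"]
          by (simp only:)
        show ?thesis unfolding eq by (simp add: field_simps power_numeral_reduce)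
      qed
      moreover have "0 \<le> w * (1 - z) ^ 3 * (1 / 4 + z + 5 / 4 * z\<^sup>2)"
        using w 3 by simp
      ultimately have "4 * z * (1 - z ^ 3 * w) \<le> ?r z * (1 - z ^ 4)" by linarith
      moreover have "z ^ (d + 2) = z ^ 3 * w" unfolding de w_def by (simp add: power_add power_numeral_reduce)
      ultimately have "4 * z * (1 - z ^ (d + 2)) / (1 - z ^ 4) \<le> ?r z"
        using z4p by (simp only: pos_divide_le_eq)
      then show ?thesis using folded_upper[OF 3] by linarith
    qed
  qed
  then show ?thesis unfolding de by simp
qed

section \<open>Exact values for at most four darts\<close>

lemma parts_list:
  obtains xs where "\<And>t. (\<Prod>C\<in>R. cycle_weight (k C) t) = prod_list (map (\<lambda>j. cycle_weight j t) xs)"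
    "sum_list xs = d" "\<forall>j\<in>set xs. j > 0"
proof -
  obtain ys where ys: "set ys = R" "distinct ys" using finite_distinct_list[OF fin] by blast
  have "(\<Prod>C\<in>R. cycle_weight (k C) t) = prod_list (map (\<lambda>j. cycle_weight j t) (map k ys))" for t
    unfolding ys(1)[symmetric] using prod.distinct_set_conv_list[OF ys(2)] by (simp add: o_def)
  moreover have "sum_list (map k ys) = d"
    using sum.distinct_set_conv_list[OF ys(2), of k] unfolding ys sum_k by simp
  ultimately show ?thesis using that[of "map k ys"] pos ys(1) by auto
qed

text \<open>The sum of \<open>p\<close> at \<open>1 / 2 - s\<close> and \<open>1 / 2 + s\<close> is
  even in \<open>s = z^2 / 2\<close>. For a polynomial \<open>p\<close> of degree at most 3 the
  folded form therefore has only the terms \<open>z\<close> and \<open>z ^ 5\<close>.\<close>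

lemma integral_eq:
  assumes "\<And>t. t \<noteq> 0 \<Longrightarrow> face_integrand (\<lambda>t. \<Prod>C\<in>R. cycle_weight (k C) t) t = p t"
    and "\<And>z. folded p z = \<alpha> * z + \<beta> * z ^ 5"
  shows "I = \<alpha> / 2 + \<beta> / 6"
proof -
  let ?A = "\<lambda>z::real. \<alpha> * z\<^sup>2 / 2 + \<beta> * z ^ 6 / 6"
  have "((\<lambda>z. \<alpha> * z + \<beta> * z ^ 5) has_integral (?A 1 - ?A 0)) {0..1}"
    by (rule fundamental_theorem_of_calculus)
       (auto intro!: derivative_eq_intros simp flip: has_real_derivative_iff_has_vector_derivative)
  then have J: "((\<lambda>z. \<alpha> * z + \<beta> * z ^ 5) has_integral (\<alpha> / 2 + \<beta> / 6)) {0..1}" by simp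
  have fin1: "finite {1::real}" by simp
  have eq: "folded (face_integrand (\<lambda>t. \<Prod>C\<in>R. cycle_weight (k C) t)) z = \<alpha> * z + \<beta> * z ^ 5"
    if "z \<in> {0..1} - {1}" for z
  proof -
    show ?thesis
      unfolding assms(2)[symmetric]
      unfolding folded_def assms(1)[OF folded_points_nonzero(1)[OF that]]
        assms(1)[OF folded_points_nonzero(2)[OF that]] ..
  qed
  show ?thesis using has_integral_unique[OF int has_integral_spike_finite[OF fin1 eq J]] .
qed

lemma integral_small:
  assumes "d \<in> {1, 2, 3, 4}"
  shows "I \<le> Delta_bound d"
proof -
  obtain xs where xs: "\<And>t. (\<Prod>C\<in>R. cycle_weight (k C) t) = prod_list (map (\<lambda>j. cycle_weight j t) xs)"
    "sum_list xs = d" "\<forall>j\<in>set xs. j > 0"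
    using parts_list by blast
  have ff2: "cycle_weight 2 t = 1 - 2 * t" for t by (simp add: cycle_weight_def power2_eq_square algebra_simps)
  have ff3: "cycle_weight 3 t = 1 - 3 * t + 3 * t\<^sup>2" for t
    by (simp add: cycle_weight_def power_numeral_reduce algebra_simps)
  have ff4: "cycle_weight 4 t = (1 - 2 * t) * (1 - 2 * t + 2 * t\<^sup>2)" for t
    by (simp add: cycle_weight_def power_numeral_reduce algebra_simps)
  have H: "Delta_bound 1 = 1" "Delta_bound 2 = 2" "Delta_bound 3 = 2" "Delta_bound 4 = 7 / 3"
    using ceiling_unique[of 1 "1 / 2 :: real"] ceiling_unique[of 2 "3 / 2 :: real"]
    by (simp_all add: Delta_bound_def harm_def numeral_nat)
  define F where "F t = (\<Prod>C\<in>R. cycle_weight (k C) t)" for t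
  \<comment> \<open>The possible lists of lengths are the compositions of \<open>d\<close>,
    enumerated by peeling off the first part.\<close>
  have split: "\<exists>a ys. zs = a # ys \<and> 0 < a \<and> a \<le> m \<and> sum_list ys = m - a \<and> (\<forall>j\<in>set ys. 0 < j)"
    if "sum_list zs = m" "m > 0" "\<forall>j\<in>set zs. 0 < j" for zs :: "nat list" and m
    using that by (cases zs) auto
  have nil: "zs = []" if "sum_list zs = 0" "\<forall>j\<in>set zs. 0 < j" for zs :: "nat list"
    using that by (cases zs) auto
  have one: "zs = [1]" if zs: "sum_list zs = 1" "\<forall>j\<in>set zs. 0 < j" for zs :: "nat list"
  proof -
    obtain a ys where "zs = a # ys" "0 < a" "a \<le> 1" "sum_list ys = 1 - a" "\<forall>j\<in>set ys. 0 < j"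
      using split[OF zs(1) _ zs(2)] by auto
    then show ?thesis using nil[of ys] by (cases "a = 1") auto
  qed
  have two: "zs = [2] \<or> zs = [1, 1]" if zs: "sum_list zs = 2" "\<forall>j\<in>set zs. 0 < j" for zs :: "nat list"
  proof -
    obtain a ys where y: "zs = a # ys" "0 < a" "a \<le> 2" "sum_list ys = 2 - a" "\<forall>j\<in>set ys. 0 < j"
      using split[OF zs(1) _ zs(2)] by auto
    then consider "a = 1" | "a = 2" by linarith
    then show ?thesis using nil[of ys] one[of ys] y by cases auto
  qed
  have three: "zs \<in> {[3], [1, 2], [2, 1], [1, 1, 1]}"
    if zs: "sum_list zs = 3" "\<forall>j\<in>set zs. 0 < j" for zs :: "nat list"
  proof -
    obtain a ys where y: "zs = a # ys" "0 < a" "a \<le> 3" "sum_list ys = 3 - a" "\<forall>j\<in>set ys. 0 < j"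
      using split[OF zs(1) _ zs(2)] by auto
    then consider "a = 1" | "a = 2" | "a = 3" by linarith
    then show ?thesis using nil[of ys] one[of ys] two[of ys] y by cases auto
  qed
  have four: "zs \<in> {[4], [3, 1], [2, 2], [2, 1, 1], [1, 3], [1, 1, 2], [1, 2, 1], [1, 1, 1, 1]}"
    if zs: "sum_list zs = 4" "\<forall>j\<in>set zs. 0 < j" for zs :: "nat list"
  proof -
    obtain a ys where y: "zs = a # ys" "0 < a" "a \<le> 4" "sum_list ys = 4 - a" "\<forall>j\<in>set ys. 0 < j"
      using split[OF zs(1) _ zs(2)] by auto
    then consider "a = 1" | "a = 2" | "a = 3" | "a = 4" by linarith
    then show ?thesis using nil[of ys] one[of ys] two[of ys] three[of ys] y by cases auto
  qed
  have I: "I = \<alpha> / 2 + \<beta> / 6"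
    if "F = f" "\<And>t. t \<noteq> 0 \<Longrightarrow> face_integrand f t = p t" "\<And>z. folded p z = \<alpha> * z + \<beta> * z ^ 5"
    for f p \<alpha> \<beta>
    by (rule integral_eq[of p]) (use that F_def in \<open>simp_all flip: F_def[abs_def]\<close>)
  \<comment> \<open>Parts equal to 1 have weight 1, so just five products occur. Each instance of
    \<open>I\<close> supplies the polynomial quotient and the two coefficients of its folded
    form.\<close>
  have I1: "I = 1" if "F = (\<lambda>t. 1)"
    using I[OF that, of "\<lambda>t. 1" 2 0] by (simp add: face_integrand_def folded_def)
  have I2: "I = 2" if "F = (\<lambda>t. 1 - 2 * t)"
    using I[OF that, of "\<lambda>t. 3 - 2 * t" 4 0]
    by (simp add: face_integrand_def folded_def field_simps)
  have I3: "I = 2" if "F = (\<lambda>t. 1 - 3 * t + 3 * t\<^sup>2)"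
    using I[OF that, of "\<lambda>t. 4 - 6 * t + 3 * t\<^sup>2" "7 / 2" "3 / 2"]
    by (simp add: face_integrand_def folded_def field_simps power_numeral_reduce)
  have I22: "I = 7 / 3" if "F = (\<lambda>t. (1 - 2 * t) * (1 - 2 * t))"
    using I[OF that, of "\<lambda>t. 5 - 8 * t + 4 * t\<^sup>2" 4 2]
    by (simp add: face_integrand_def folded_def field_simps power_numeral_reduce)
  have I4: "I = 7 / 3" if "F = (\<lambda>t. (1 - 2 * t) * (1 - 2 * t + 2 * t\<^sup>2))"
    using I[OF that, of "\<lambda>t. 5 - 10 * t + 10 * t\<^sup>2 - 4 * t ^ 3" 4 2]
    by (simp add: face_integrand_def folded_def field_simps power_numeral_reduce)
  have F: "F = (\<lambda>t. prod_list (map (\<lambda>j. cycle_weight j t) xs))"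
    unfolding F_def xs(1) ..
  consider "d = 1" | "d = 2" | "d = 3" | "d = 4" using assms by auto
  then show ?thesis
  proof cases
    case 1
    then have "F = (\<lambda>t. 1)" using one[OF _ xs(3)] xs(2) unfolding F by simp
    then show ?thesis using I1 H 1 by simp
  next
    case 2
    then have "F = (\<lambda>t. 1) \<or> F = (\<lambda>t. 1 - 2 * t)"
      using two[OF _ xs(3)] xs(2) unfolding F by (auto simp: ff2)
    then show ?thesis using I1 I2 H 2 by auto
  next
    case 3
    then have "F = (\<lambda>t. 1) \<or> F = (\<lambda>t. 1 - 2 * t) \<or> F = (\<lambda>t. 1 - 3 * t + 3 * t\<^sup>2)"
      using three[OF _ xs(3)] xs(2) unfolding F by (auto simp: ff2 ff3)
    then show ?thesis using I1 I2 I3 H 3 by auto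
  next
    case 4
    then have "F = (\<lambda>t. 1) \<or> F = (\<lambda>t. 1 - 2 * t) \<or> F = (\<lambda>t. 1 - 3 * t + 3 * t\<^sup>2) \<or>
      F = (\<lambda>t. (1 - 2 * t) * (1 - 2 * t)) \<or> F = (\<lambda>t. (1 - 2 * t) * (1 - 2 * t + 2 * t\<^sup>2))"
      using four[OF _ xs(3)] xs(2) unfolding F by (auto simp: ff2 ff3 ff4)
    then show ?thesis using I1 I2 I3 I22 I4 H 4 by auto
  qed
qed

text \<open>For \<open>d \<ge> 5\<close>, rounding gives
  \<open>\<lceil>d / 2\<rceil> \<le> (d + 1) / 2\<close>, so \<open>h_bound d\<close> is at least
  \<open>harm (d - 1) + 3 / (d + 1)\<close>, and this exceeds the bound of
  \<open>integral_upper\<close>.\<close>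

lemma integral_le_h_bound:
  assumes d: "d \<ge> 1"
  shows "I \<le> h_bound d"
proof (cases "d \<le> 4")
  case True
  then have "d \<in> {1, 2, 3, 4}" using d by auto
  then show ?thesis using integral_small True by (simp add: h_bound_def)
next
  case False
  have "\<lceil>real d / 2\<rceil> \<le> (int d + 1) div 2"
  proof (rule ceiling_le)
    have "int d \<le> 2 * ((int d + 1) div 2)" by linarith
    then have "real_of_int (int d) \<le> real_of_int (2 * ((int d + 1) div 2))" by (simp only: of_int_le_iff)
    then show "real d / 2 \<le> real_of_int ((int d + 1) div 2)" by simp
  qed
  then have "2 * \<lceil>real d / 2\<rceil> \<le> int d + 1" by linarith
  then have c: "2 * real_of_int \<lceil>real d / 2\<rceil> \<le> real d + 1" by linarith
  have cpos: "0 < real_of_int \<lceil>real d / 2\<rceil>" using d by simp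
  have "5 / 4 * (1 / real d + 1 / (real d + 1)) \<le> 2 / (real d + 1) + 1 / (real d + 1)"
  proof -
    \<comment> \<open>The constant is \<open>7 / 5 = 3 * 4 / 5 - 1\<close>, exactly what turns
      \<open>5 / 4 * (p + q)\<close> into at most \<open>3 * q\<close>.\<close>
    have "1 / real d \<le> 7 / 5 * (1 / (real d + 1))" using False by (simp add: field_simps)
    moreover have "5 / 4 * (p + q) \<le> 3 * q" if "p \<le> 7 / 5 * q" for p q :: real
      using that by (simp add: field_simps)
    ultimately have "5 / 4 * (1 / real d + 1 / (real d + 1)) \<le> 3 * (1 / (real d + 1))" by blast
    also have "\<dots> = 2 / (real d + 1) + 1 / (real d + 1)" by (simp flip: add_divide_distrib)
    finally show ?thesis .
  qed
  also have "2 / (real d + 1) \<le> inverse (real_of_int \<lceil>real d / 2\<rceil>)"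
    using c cpos by (simp add: field_simps)
  finally have "harm (d - 1) + 5 / 4 * (1 / real d + 1 / (real d + 1)) \<le> h_bound d"
    using False by (simp add: h_bound_def Delta_bound_def)
  then show ?thesis using integral_upper False by (simp add: add.commute)
qed

end

section \<open>Faces through a vertex\<close>

lemma mean_cycles_le_h_bound:
  assumes "finite S" "S \<noteq> {}" "\<tau> permutes S"
  shows "mean_cycles S \<tau> \<le> h_bound (card S)"
proof (rule integral_le_h_bound[where R = "orbit \<tau> ` S" and k = card])
  show "finite (orbit \<tau> ` S)" using assms by simp
  have sub: "C \<subseteq> S" "C \<noteq> {}" if "C \<in> orbit \<tau> ` S" for C
    using that permutes_orbit_subset[OF assms(3)] orbit_nonempty[of \<tau>] by auto
  have finC: "finite C" if "C \<in> orbit \<tau> ` S" for C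
    using sub(1)[OF that] assms(1) by (rule finite_subset)
  show "card C > 0" if "C \<in> orbit \<tau> ` S" for C
    using sub(2)[OF that] finC[OF that] by (simp add: card_gt_0_iff)
  have "card (\<Union>(orbit \<tau> ` S)) = (\<Sum>C\<in>orbit \<tau> ` S. card C)"
  proof (rule card_Union_disjoint)
    show "pairwise disjnt (orbit \<tau> ` S)"
      unfolding pairwise_def disjnt_def using orbits_disjoint[OF assms(1,3)] by simp
  qed (rule finC)
  then show "(\<Sum>C\<in>orbit \<tau> ` S. card C) = card S"
    unfolding Union_orbits[OF assms(1,3)] ..
  show "(folded (face_integrand (\<lambda>t. \<Prod>C\<in>orbit \<tau> ` S. cycle_weight (card C) t)) has_integral mean_cycles S \<tau>) {0..1}"
    using mean_cycles_has_integral[OF assms] by (simp add: orbit_prod_def)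
  show "card S \<ge> 1" using assms by (simp add: Suc_le_eq card_gt_0_iff)
qed

text \<open>The witness \<open>\<tau>\<close> is the first-return map of \<open>\<alpha>\<close> on \<open>D\<close>.\<close>

lemma first_return:
  assumes "finite A" "\<alpha> permutes A" "D \<subseteq> A"
  shows "\<exists>\<tau>. \<tau> permutes D \<and>
    (\<forall>\<rho>. \<rho> permutes D \<longrightarrow> card (orbit (\<alpha> \<circ> \<rho>) ` D) = card (orbit (\<tau> \<circ> \<rho>) ` D))"
  using assms
proof (induction "card (A - D)" arbitrary: A \<alpha>)
  case 0
  then have "A = D" by auto
  then show ?case using 0 by blast
next
  case (Suc n)
  then obtain x where x: "x \<in> A" "x \<notin> D" by (metis Diff_iff card.empty equals0I nat.distinct(1))
  \<comment> \<open>The points outside \<open>D\<close> are deleted one at a time. Every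
    \<open>\<rho>\<close> fixes them, so the deletion affects only the left factor
    \<open>\<alpha>\<close>.\<close>
  have "\<exists>\<tau>. \<tau> permutes D \<and>
    (\<forall>\<rho>. \<rho> permutes D \<longrightarrow> card (orbit (del_point x \<alpha> \<circ> \<rho>) ` D) = card (orbit (\<tau> \<circ> \<rho>) ` D))"
  proof (rule Suc.hyps(1))
    have "A - {x} - D = A - D - {x}" by auto
    then show "n = card (A - {x} - D)" using Suc.hyps(2) x by simp
    show "del_point x \<alpha> permutes A - {x}" using Suc.prems(2) x(1) by (rule del_point_permutes)
  qed (use Suc.prems x in auto)
  moreover have "card (orbit (del_point x \<alpha> \<circ> \<rho>) ` D) = card (orbit (\<alpha> \<circ> \<rho>) ` D)" if r: "\<rho> permutes D" for \<rho>
  proof -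
    have "\<rho> x = x" using r x(2) by (rule permutes_not_in)
    then have "del_point x (\<alpha> \<circ> \<rho>) = del_point x \<alpha> \<circ> \<rho>" by (rule del_point_comp)
    moreover have "\<alpha> \<circ> \<rho> permutes A"
      using r Suc.prems by (intro permutes_compose permutes_subset[OF r])
    then have "card (orbit (del_point x (\<alpha> \<circ> \<rho>)) ` D) = card (orbit (\<alpha> \<circ> \<rho>) ` D)"
      using Suc.prems x by (intro card_orbits_del_point) auto
    ultimately show ?thesis by simp
  qed
  ultimately show ?case by metis
qed

lemma random_insert_permutes:
  assumes fin: "finite S" and p: "p permutes S" and x: "x \<notin> S" and q: "q \<in> set_pmf (random_insert p S x)"
  shows "q permutes insert x S"
proof (cases "S = {}")
  case True
  then show ?thesis using q by (simp add: random_insert_def permutes_id)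
next
  case False
  then obtain a where a: "a \<in> S" and q: "q = p(a := x, x := p a)"
    using q fin by (auto simp: random_insert_def)
  have "p x = x" using p x by (rule permutes_not_in)
  \<comment> \<open>Inserting \<open>x\<close> after \<open>a\<close> is composition with a
    transposition on the right.\<close>
  then have eq: "q = p \<circ> Transposition.transpose a x"
    using a x unfolding q by (auto simp: fun_eq_iff Transposition.transpose_def)
  show ?thesis
    unfolding eq using a by (intro permutes_compose permutes_swap_id permutes_subset[OF p]) auto
qed

lemma finite_random_insert: "finite S \<Longrightarrow> finite (set_pmf (random_insert p S x))"
  by (simp add: random_insert_def)

lemma cyclic_perms_permutes: "p \<in> cyclic_perms S \<Longrightarrow> p permutes S"
  by (simp add: cyclic_perms_def)


section \<open>Faces as cycles on the darts at \<open>v\<close>\<close>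

context
  fixes A :: "('a \<times> 'a) set" and v :: 'a and f :: "'a rotations"
  assumes fin: "finite A" and symA: "sym A"
    and f: "\<And>u. u \<in> fst ` A \<Longrightarrow> u \<noteq> v \<Longrightarrow> f u permutes {e \<in> A. fst e = u}"
begin

text \<open>The face permutation with the rotation at \<open>v\<close> replaced by the identity.
  Composed with \<open>\<rho>\<close> it agrees on \<open>A\<close> with the face permutation of
  \<open>f(v := \<rho>)\<close>; being the identity off \<open>A\<close> makes it a permutation of
  \<open>A\<close>.\<close>

definition rest_perm :: "'a \<times> 'a \<Rightarrow> 'a \<times> 'a" where
  "rest_perm a = (if a \<in> A then prod.swap (if fst a = v then a else f (fst a) a) else a)"

lemma rest_perm_swap:
  assumes "a \<in> A"
  shows "prod.swap (rest_perm a) \<in> A" "snd (rest_perm a) = fst a"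
proof -
  have "f (fst a) a \<in> {e \<in> A. fst e = fst a}" if "fst a \<noteq> v"
    using permutes_in_image[OF f[of "fst a"], of a] that assms by blast
  then show "prod.swap (rest_perm a) \<in> A" "snd (rest_perm a) = fst a"
    using assms by (auto simp: rest_perm_def)
qed

lemma swap_arc: "prod.swap a \<in> A \<longleftrightarrow> a \<in> A"
  using symA by (cases a) (auto dest: symD)

lemma rest_perm_permutes: "rest_perm permutes A"
proof (rule bij_imp_permutes)
  have swap_inj: "prod.swap x = prod.swap y \<longleftrightarrow> x = y" for x y :: "'a \<times> 'a" by (metis swap_swap)
  have "inj_on rest_perm A"
  proof (rule inj_onI)
    fix a b assume ab: "a \<in> A" "b \<in> A" "rest_perm a = rest_perm b"
    \<comment> \<open>The head of the image is the tail of the dart, so injectivity need only be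
      checked at one vertex.\<close>
    then have fst: "fst a = fst b" using rest_perm_swap(2) by metis
    show "a = b"
    proof (cases "fst a = v")
      case True
      then show ?thesis using ab fst by (simp add: rest_perm_def prod_eq_iff)
    next
      case False
      then have "f (fst a) a = f (fst a) b" 
        using ab fst swap_inj by (simp add: rest_perm_def)
      moreover have "inj (f (fst a))" using f[of "fst a"] ab(1) False by (intro permutes_inj) auto
      ultimately show ?thesis by (simp add: inj_eq)
    qed
  qed
  moreover have "rest_perm ` A \<subseteq> A" using rest_perm_swap(1) swap_arc by blast
  ultimately show "bij_betw rest_perm A A"
    using fin by (simp add: bij_betw_def endo_inj_surj)
qed (simp add: rest_perm_def)

lemma faces_through_vertex:
  assumes \<rho>: "\<rho> permutes {e \<in> A. fst e = v}"
  shows "{F \<in> orbit (face_perm (f(v := \<rho>))) ` A. face_contains F v} =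
    orbit (rest_perm \<circ> \<rho>) ` {e \<in> A. fst e = v}"
proof -
  let ?D = "{e \<in> A. fst e = v}" and ?q = "rest_perm \<circ> \<rho>"
  have q: "?q permutes A"
    by (rule permutes_compose[OF permutes_subset[OF \<rho>] rest_perm_permutes]) auto
  then have perm: "permutation ?q" using fin by (auto simp: permutation_permutes)
  have eq: "?q a = face_perm (f(v := \<rho>)) a" if a: "a \<in> A" for a
  proof (cases "fst a = v")
    case True
    then have "\<rho> a \<in> ?D" using permutes_in_image[OF \<rho>, of a] a by blast
    then show ?thesis using True by (simp add: face_perm_def rest_perm_def)
  next
    case False
    then have "\<rho> a = a" using permutes_not_in[OF \<rho>, of a] by blast
    then show ?thesis using False a by (simp add: face_perm_def rest_perm_def)
  qed
  have "orbit (face_perm (f(v := \<rho>))) a = orbit ?q a" if "a \<in> A" for a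
    using that q eq by (intro orbit_cong0[symmetric, of a A]) (auto simp only: Pi_iff permutes_in_image)
  then have orb: "orbit (face_perm (f(v := \<rho>))) ` A = orbit ?q ` A" by (rule image_cong[OF refl])
  have self: "a \<in> orbit ?q a" for a by (rule permutation_self_in_orbit[OF perm])
  show ?thesis unfolding orb
  proof (intro set_eqI iffI)
    fix F assume "F \<in> {F \<in> orbit ?q ` A. face_contains F v}"
    then obtain a e where a: "a \<in> A" "F = orbit ?q a" and e: "e \<in> F" "fst e = v \<or> snd e = v"
      unfolding face_contains_def by blast
    have eA: "e \<in> A" using a e permutes_orbit_subset[OF q a(1)] by blast
    have Fe: "F = orbit ?q e" using e(1) unfolding a(2) orbit_eq_iff_mem[OF perm, symmetric] by (rule sym)
    show "F \<in> orbit ?q ` ?D"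
    proof (cases "fst e = v")
      case True
      then show ?thesis using Fe eA by blast
    next
      case False
      then have snd: "snd e = v" using e(2) by blast
      \<comment> \<open>A face that meets \<open>v\<close> only in the head of \<open>e\<close> is
        excluded: the dart preceding \<open>e\<close> on the face has tail \<open>v\<close>.\<close>
      define b where "b = inv ?q e"
      have qb: "?q b = e" unfolding b_def by (rule permutes_inverses(1)[OF q])
      have bA: "b \<in> A" using eA qb permutes_in_image[OF q, of b] by simp
      have "\<rho> b \<in> A" using bA permutes_in_image[OF permutes_subset[OF \<rho>], of A b] by blast
      then have "fst (\<rho> b) = v" using rest_perm_swap(2)[of "\<rho> b"] qb snd by simp
      then have "\<rho> b \<in> ?D" using \<open>\<rho> b \<in> A\<close> by blast
      then have "b \<in> ?D" using permutes_in_image[OF \<rho>, of b] by simp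
      moreover have "F = orbit ?q b"
        unfolding Fe qb[symmetric] by (rule permutation_orbit_step[OF perm])
      ultimately show ?thesis by blast
    qed
  next
    fix F assume "F \<in> orbit ?q ` ?D"
    then obtain d where "d \<in> A" "fst d = v" "F = orbit ?q d" by blast
    then show "F \<in> {F \<in> orbit ?q ` A. face_contains F v}"
      using self[of d] unfolding face_contains_def by blast
  qed
qed

lemma mean_faces_le:
  assumes ne: "{e \<in> A. fst e = v} \<noteq> {}"
  shows "(\<Sum>\<rho>\<in>cyclic_perms {e \<in> A. fst e = v}.
      real (card {F \<in> orbit (face_perm (f(v := \<rho>))) ` A. face_contains F v}))
      / real (card (cyclic_perms {e \<in> A. fst e = v}))
    \<le> h_bound (card {e \<in> A. fst e = v})"
proof -
  let ?D = "{e \<in> A. fst e = v}"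
  obtain \<tau> where \<tau>: "\<tau> permutes ?D"
    "\<And>\<rho>. \<rho> permutes ?D \<Longrightarrow> card (orbit (rest_perm \<circ> \<rho>) ` ?D) = card (orbit (\<tau> \<circ> \<rho>) ` ?D)"
    using first_return[OF fin rest_perm_permutes, of ?D] by blast
  have "(\<Sum>\<rho>\<in>cyclic_perms ?D. real (card {F \<in> orbit (face_perm (f(v := \<rho>))) ` A. face_contains F v})) =
    (\<Sum>\<rho>\<in>cyclic_perms ?D. real (card (orbit (\<tau> \<circ> \<rho>) ` ?D)))"
  proof (rule sum.cong[OF refl])
    fix \<rho> assume "\<rho> \<in> cyclic_perms ?D"
    then have "\<rho> permutes ?D" by (rule cyclic_perms_permutes)
    then show "real (card {F \<in> orbit (face_perm (f(v := \<rho>))) ` A. face_contains F v}) =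
        real (card (orbit (\<tau> \<circ> \<rho>) ` ?D))"
      by (simp only: faces_through_vertex \<tau>(2))
  qed
  then show ?thesis
    using mean_cycles_le_h_bound[OF _ ne \<tau>(1)] fin by (simp add: mean_cycles_def)
qed

end

lemma expectation_bind_le:
  fixes h :: "'b \<Rightarrow> real"
  assumes "finite (set_pmf p)" "\<And>x. x \<in> set_pmf p \<Longrightarrow> finite (set_pmf (k x))"
    and "\<And>x. x \<in> set_pmf p \<Longrightarrow> measure_pmf.expectation (k x) h \<le> c"
  shows "measure_pmf.expectation (bind_pmf p k) h \<le> c"
proof -
  have "measure_pmf.expectation (bind_pmf p k) h =
      (\<Sum>x\<in>set_pmf p. pmf p x *\<^sub>R measure_pmf.expectation (k x) h)"
    using assms by (intro pmf_expectation_bind) auto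
  also have "\<dots> \<le> (\<Sum>x\<in>set_pmf p. pmf p x * c)"
    using assms(3) by (intro sum_mono) (simp add: mult_left_mono)
  also have "\<dots> = c"
    using sum_pmf_eq_1[OF assms(1)] by (simp flip: sum_distrib_right)
  finally show ?thesis .
qed

theorem theorem7:
  fixes G' :: "'a pair_pre_digraph" and v :: 'a and d :: nat and \<pi> :: "'a rotations"
  assumes "pair_graph G'"
    and "v \<in> pverts G'"
    and "d = out_degree (with_proj G') v"
    and "d \<ge> 1"
    and "rotation_system (pre_digraph.del_vert (with_proj G') v) \<pi>"
  shows "measure_pmf.expectation (randomly_add_vertex (with_proj G') v \<pi>)
           (\<lambda>\<pi>'. real (card {F \<in> faces (with_proj G') \<pi>'. face_contains F v}))
         \<le> h_bound d"
proof -
  interpret pair_graph G' by fact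
  let ?A = "parcs G'" and ?V = "pverts G'"
  let ?D = "{e \<in> ?A. fst e = v}"
  let ?S = "\<lambda>u. {e \<in> ?A. fst e = u \<and> fst e \<noteq> v \<and> snd e \<noteq> v}"
  define X where "X p = real (card {F \<in> orbit (face_perm p) ` ?A. face_contains F v})" for p
  define K where "K u = (if u = v then pmf_of_set (cyclic_perms ?D)
            else if (u, v) \<in> ?A then random_insert (\<pi> u) (?S u) (u, v)
            else return_pmf (\<pi> u))" for u
  have finA: "finite ?A" by (rule pair_finite_arcs)
  have finV: "finite ?V" by (rule pair_finite_verts)
  have out: "out_arcs (with_proj G') u = {e \<in> ?A. fst e = u}" for u
    by (simp add: out_arcs_def)
  have out': "out_arcs (pre_digraph.del_vert (with_proj G') v) u = ?S u" for u
    by (auto simp: out_arcs_def pre_digraph.del_vert_def)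
  have d: "d = card ?D" using assms(3) by (simp add: out_degree_def out)
  then have ne: "?D \<noteq> {}" using assms(4) by (metis card.empty not_one_le_zero)
  have finD: "finite ?D" using finA by simp
  have cyc: "cyclic_perms ?D \<noteq> {}" "finite (cyclic_perms ?D)"
    using cyclic_perms_nonempty[OF finD ne] finite_cyclic_perms[OF finD] by auto
  have \<pi>: "\<pi> u permutes ?S u" if "u \<in> ?V" "u \<noteq> v" for u
  proof -
    have "u \<in> verts (pre_digraph.del_vert (with_proj G') v)"
      using that by (simp add: pre_digraph.del_vert_def)
    then have "\<pi> u \<in> cyclic_perms (?S u)"
      using assms(5) unfolding rotation_system_def out' by blast
    then show ?thesis by (rule cyclic_perms_permutes)
  qed
  have S: "{e \<in> ?A. fst e = u} = (if (u, v) \<in> ?A then insert (u, v) (?S u) else ?S u)" if "u \<noteq> v" for u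
    using that by auto
  have K: "q permutes {e \<in> ?A. fst e = u}" if u: "u \<in> ?V" "u \<noteq> v" and q: "q \<in> set_pmf (K u)" for u q
  proof (cases "(u, v) \<in> ?A")
    case True
    then have "q \<in> set_pmf (random_insert (\<pi> u) (?S u) (u, v))" using q u by (simp add: K_def)
    then have "q permutes insert (u, v) (?S u)"
      using finA \<pi>[OF u] by (intro random_insert_permutes[of "?S u" "\<pi> u"]) auto
    then show ?thesis using True unfolding S[OF u(2)] by simp
  next
    case False
    then show ?thesis using q u \<pi>[OF u] unfolding S[OF u(2)] by (simp add: K_def)
  qed
  have finK: "finite (set_pmf (K u))" for u
    unfolding K_def using cyc finA by (simp add: finite_random_insert)
  let ?P = "Pi_pmf (?V - {v}) id K"
  have "randomly_add_vertex (with_proj G') v \<pi> = Pi_pmf (insert v (?V - {v})) id K"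
    unfolding randomly_add_vertex_def out out' K_def[abs_def] with_proj_simps using assms(2) by (simp add: insert_absorb)
  also have "\<dots> = bind_pmf (K v) (\<lambda>\<rho>. bind_pmf ?P (\<lambda>f. return_pmf (f(v := \<rho>))))"
    using finV by (intro Pi_pmf_insert') auto
  \<comment> \<open>By independence the rotation at \<open>v\<close> can be drawn last. The bound
    then holds conditionally on every choice \<open>f\<close> of the other rotations.\<close>
  also have "\<dots> = bind_pmf ?P (\<lambda>f. bind_pmf (K v) (\<lambda>\<rho>. return_pmf (f(v := \<rho>))))"
    by (rule bind_commute_pmf)
  also have "measure_pmf.expectation \<dots> X \<le> h_bound d"
  proof (rule expectation_bind_le)
    show "finite (set_pmf ?P)"
      using finV finK by (simp add: set_Pi_pmf finite_PiE_dflt)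
    show "finite (set_pmf (bind_pmf (K v) (\<lambda>\<rho>. return_pmf (f(v := \<rho>)))))" for f
      using finK[of v] by simp
    fix f assume fP: "f \<in> set_pmf ?P"
    have f: "f u permutes {e \<in> ?A. fst e = u}" if "u \<in> fst ` ?A" "u \<noteq> v" for u
    proof -
      have "u \<in> ?V" using that(1) arc_fst_in_verts by blast
      moreover from this have "f u \<in> set_pmf (K u)"
        using fP that(2) finV by (simp add: set_Pi_pmf PiE_dflt_def)
      ultimately show ?thesis using that(2) by (intro K)
    qed
    have "bind_pmf (K v) (\<lambda>\<rho>. return_pmf (f(v := \<rho>))) = map_pmf (\<lambda>\<rho>. f(v := \<rho>)) (pmf_of_set (cyclic_perms ?D))"
      by (simp add: map_pmf_def K_def)
    then have "measure_pmf.expectation (bind_pmf (K v) (\<lambda>\<rho>. return_pmf (f(v := \<rho>)))) X =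
        (\<Sum>\<rho>\<in>cyclic_perms ?D. X (f(v := \<rho>))) / real (card (cyclic_perms ?D))"
      using cyc by (simp add: integral_pmf_of_set)
    also have "\<dots> \<le> h_bound d"
      unfolding X_def d
      by (rule mean_faces_le[OF finA _ f ne]) (use pair_sym_arcs in \<open>simp add: symmetric_def\<close>)
    finally show "measure_pmf.expectation (bind_pmf (K v) (\<lambda>\<rho>. return_pmf (f(v := \<rho>)))) X \<le> h_bound d" .
  qed
  finally show ?thesis by (simp add: X_def[abs_def] faces_def)
qed

end
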